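(* Let $A \in \mathcal{B}(\mathcal{H},\mathcal{K})$, let $B$ be a closed densely defined operator in $\mathcal{H}$ and $T$ a closed densely defined operator in $\mathcal{K}$, and suppose that either (a) $B$ is subnormal and $T$ is $M$-hyponormal, or (b) $B$ is $M$-hyponormal and $T$ is subnormal. If $AB^* \subseteq TA$, then: (i) $AB \subseteq T^*A$; (ii) $\mathcal{R}(A^* )$ reduces $B$ to the normal operator $B|_{\mathcal{R}(A^* )}$, i.e. $\mathcal{R}(A^* )$ reduces $B$ and $B|_{\mathcal{R}(A^* )}$ is a normal operator in $\mathcal{R}(A^* )$; (iii) $\mathcal{R}(A)$ reduces $T$ to the normal operator $T|_{\mathcal{R}(A)}$, i.e. $\mathcal{R}(A)$ reduces $T$ and $T|_{\mathcal{R}(A)}$ is a normal operator in $\mathcal{R}(A)$.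
   Context: $\mathcal{H},\mathcal{K}$ are infinite-dimensional complex Hilbert spaces; $\mathcal{B}(\mathcal{H},\mathcal{K})$ is the space of bounded linear operators from $\mathcal{H}$ to $\mathcal{K}$. Operators such as $B,T$ are possibly unbounded linear operators with domains $\mathcal{D}(B),\mathcal{D}(T)$. For unbounded operators, $X\subseteq Y$ means that $Y$ extends $X$ (i.e. $\mathcal{D}(X)\subseteq\mathcal{D}(Y)$ and $Xx=Yx$ for $x\in\mathcal{D}(X)$), and products have their natural maximal domains. A closed densely defined operator $T$ in a Hilbert space is called $M$-hyponormal if $\mathcal{D}(T)\subseteq \mathcal{D}(T^* )$ and there exists a constant $M>0$ such that $\|(T-zI)^*x\|\le M\|(T-zI)x\|$ for all $z\in\mathbb{C}$ and all $x\in\mathcal{D}(T)$. A closed operator $B$ in $\mathcal{H}$ is called subnormal if there are a Hilbert space $\mathcal{L}\supseteq\mathcal{H}$ and a normal operator $S$ in $\mathcal{L}$ such that $B\subseteq S$. Notation: $\mathcal{R}(A)=\overline{\operatorname{ran}(A)}$ and $\mathcal{R}(A^* )=\overline{\operatorname{ran}(A^* )}$. For a closed subspace $\mathcal{M}$, the operator $T|_{\mathcal{M}}$ in $\mathcal{M}$ has domain $\{x\in\mathcal{D}(T)\cap\mathcal{M}: Tx\in\mathcal{M}\}$ and acts as $T$. $\mathcal{M}$ is invariant under $T$ if $Tx\in\mathcal{M}$ for every $x\in\mathcal{D}(T)\cap\mathcal{M}$. $\mathcal{M}$ reduces $T$ if both $\mathcal{M}$ and $\mathcal{M}^\perp$ are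 invariant under $T$. *)

theory Defs
  imports "HOL-Analysis.Analysis"
begin

section \<open>Complex Hilbert spaces\<close>

class scaleC =
  fixes scaleC :: "complex \<Rightarrow> 'a \<Rightarrow> 'a" (infixr "*\<^sub>C" 75)

class complex_vector = real_vector + scaleC +
  assumes scaleC_add_right: "a *\<^sub>C (x + y) = a *\<^sub>C x + a *\<^sub>C y"
    and scaleC_add_left: "(a + b) *\<^sub>C x = a *\<^sub>C x + b *\<^sub>C x"
    and scaleC_scaleC: "a *\<^sub>C b *\<^sub>C x = (a * b) *\<^sub>C x"
    and scaleC_one: "1 *\<^sub>C x = x"
    and scaleR_scaleC: "r *\<^sub>R x = complex_of_real r *\<^sub>C x"

global_interpretation complex_vector: vector_space "scaleC :: complex \<Rightarrow> 'a \<Rightarrow> 'a::complex_vector"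
  defines csubspace = complex_vector.subspace
    and cspan = complex_vector.span
  by unfold_locales (rule scaleC_add_right scaleC_add_left scaleC_scaleC scaleC_one)+

text \<open>
  The real inner product of the parent class is the real part of the complex one, so norm,
  metric and topology are those induced by \<open>cinner\<close>, and positive definiteness is inherited
  (lemma \<open>cinner_self\<close>).  \<open>cinner\<close> is linear in its first argument.
\<close>

class complex_inner = complex_vector + real_inner +
  fixes cinner :: "'a \<Rightarrow> 'a \<Rightarrow> complex"
  assumes cinner_commute: "cinner x y = cnj (cinner y x)"
    and cinner_add_left: "cinner (x + y) z = cinner x z + cinner y z"
    and cinner_scaleC_left: "cinner (c *\<^sub>C x) y = c * cinner x y"
    and inner_eq_Re_cinner: "inner x y = Re (cinner x y)"

lemma cinner_self: "cinner x x = complex_of_real ((norm x)\<^sup>2)"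
proof -
  have "Im (cinner x x) = 0"
    using arg_cong[OF cinner_commute[of x x], of Im] by simp
  moreover have "Re (cinner x x) = (norm x)\<^sup>2"
    by (simp add: power2_norm_eq_inner inner_eq_Re_cinner)
  ultimately show ?thesis
    by (simp add: complex_eq_iff)
qed

class complex_hilbert = complex_inner + complete_space

instantiation complex :: complex_hilbert
begin
definition "scaleC_complex (c::complex) (x::complex) = c * x"
definition "cinner_complex (x::complex) (y::complex) = x * cnj y"
instance
  by standard
    (simp_all add: scaleC_complex_def cinner_complex_def algebra_simps inner_complex_def
      scaleR_conv_of_real)
end

instantiation prod :: (complex_vector, complex_vector) complex_vector
begin
definition "scaleC_prod (c::complex) (p :: 'a \<times> 'b) = (c *\<^sub>C fst p, c *\<^sub>C snd p)"
instance
  by standard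
    (simp_all add: scaleC_prod_def prod_eq_iff scaleC_add_right scaleC_add_left scaleC_scaleC
      scaleC_one scaleR_scaleC)
end

definition infinite_dimensional :: "'a::complex_vector itself \<Rightarrow> bool" where
  "infinite_dimensional _ \<longleftrightarrow> \<not> (\<exists>F :: 'a set. finite F \<and> cspan F = UNIV)"

definition clinear_map :: "('a::complex_vector \<Rightarrow> 'b::complex_vector) \<Rightarrow> bool" where
  "clinear_map f \<longleftrightarrow> (\<forall>x y. f (x + y) = f x + f y) \<and> (\<forall>c x. f (c *\<^sub>C x) = c *\<^sub>C f x)"

definition bounded_clinear_map :: "('a::complex_inner \<Rightarrow> 'b::complex_inner) \<Rightarrow> bool" where
  "bounded_clinear_map f \<longleftrightarrow> clinear_map f \<and> (\<exists>C. \<forall>x. norm (f x) \<le> C * norm x)"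

definition ortho_compl :: "'a::complex_inner set \<Rightarrow> 'a set" where
  "ortho_compl M = {x. \<forall>y\<in>M. cinner x y = 0}"

section \<open>Unbounded operators\<close>

text \<open>
  A possibly unbounded operator is represented by its graph, a single-valued complex subspace
  of the product space.  The domain is \<open>Domain T\<close>, the range is \<open>Range T\<close>,
  and the extension relation between operators is inclusion of graphs.
\<close>

definition linear_operator :: "('a::complex_vector \<times> 'b::complex_vector) set \<Rightarrow> bool" where
  "linear_operator T \<longleftrightarrow> csubspace T \<and> single_valued T"

definition closed_operator :: "('a::complex_hilbert \<times> 'b::complex_hilbert) set \<Rightarrow> bool" where
  "closed_operator T \<longleftrightarrow> linear_operator T \<and> closed T"

definition op_of :: "('a \<Rightarrow> 'b) \<Rightarrow> ('a \<times> 'b) set" where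
  "op_of f = {(x, f x) | x. True}"

text \<open>Product with its maximal domain; \<open>Y\<close> is applied first.\<close>

definition op_comp :: "('b \<times> 'c) set \<Rightarrow> ('a \<times> 'b) set \<Rightarrow> ('a \<times> 'c) set" (infixr "\<circ>\<^sub>o" 75) where
  "X \<circ>\<^sub>o Y = {(x, z). \<exists>y. (x, y) \<in> Y \<and> (y, z) \<in> X}"

definition op_shift :: "('a::complex_vector \<times> 'a) set \<Rightarrow> complex \<Rightarrow> ('a \<times> 'a) set" where
  "op_shift T z = {(x, y - z *\<^sub>C x) | x y. (x, y) \<in> T}"

text \<open>
  The adjoint of \<open>T\<close> regarded as an operator from the Hilbert space \<open>M\<close> to the Hilbert space
  \<open>N\<close>, where \<open>M\<close> and \<open>N\<close> are closed subspaces of the ambient spaces.  It is single-valued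
  exactly when the domain of \<open>T\<close> is dense in \<open>M\<close>.
\<close>

definition adjoint_in ::
  "'a::complex_inner set \<Rightarrow> 'b::complex_inner set \<Rightarrow> ('a \<times> 'b) set \<Rightarrow> ('b \<times> 'a) set" where
  "adjoint_in M N T =
     {(y, w). y \<in> N \<and> w \<in> M \<and> (\<forall>(x, v)\<in>T. cinner v y = cinner x w)}"

abbreviation op_adj :: "('a::complex_inner \<times> 'b::complex_inner) set \<Rightarrow> ('b \<times> 'a) set" where
  "op_adj T \<equiv> adjoint_in UNIV UNIV T"

definition densely_defined_in :: "'a::complex_inner set \<Rightarrow> ('a \<times> 'b) set \<Rightarrow> bool" where
  "densely_defined_in M T \<longleftrightarrow> Domain T \<subseteq> M \<and> M \<subseteq> closure (Domain T)"

abbreviation densely_defined :: "('a::complex_inner \<times> 'b) set \<Rightarrow> bool" where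
  "densely_defined T \<equiv> densely_defined_in UNIV T"

definition normal_in :: "'a::complex_hilbert set \<Rightarrow> ('a \<times> 'a) set \<Rightarrow> bool" where
  "normal_in M N \<longleftrightarrow>
     N \<subseteq> M \<times> M \<and> closed_operator N \<and> densely_defined_in M N \<and>
     adjoint_in M M N \<circ>\<^sub>o N = N \<circ>\<^sub>o adjoint_in M M N"

abbreviation normal :: "('a::complex_hilbert \<times> 'a) set \<Rightarrow> bool" where
  "normal N \<equiv> normal_in UNIV N"

definition M_hyponormal :: "('a::complex_hilbert \<times> 'a) set \<Rightarrow> bool" where
  "M_hyponormal T \<longleftrightarrow>
     closed_operator T \<and> densely_defined T \<and> Domain T \<subseteq> Domain (op_adj T) \<and>
     (\<exists>M>0. \<forall>z x u v. (x, u) \<in> op_adj (op_shift T z) \<longrightarrow> (x, v) \<in> op_shift T z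
        \<longrightarrow> norm u \<le> M * norm v)"

text \<open>
  HOL cannot quantify over the larger Hilbert space inside a definition, so its type \<open>'l\<close> is a
  parameter.  The original space is identified with its image under the isometric
  embedding \<open>V\<close>.  When \<open>subnormal TYPE('l) B\<close> is a premise of a theorem in which the type variable
  \<open>'l\<close> occurs nowhere else, the implicit universal quantification over \<open>'l\<close> amounts to the premise
  that an extension exists in some Hilbert space.
\<close>

definition subnormal :: "'l::complex_hilbert itself \<Rightarrow> ('a::complex_hilbert \<times> 'a) set \<Rightarrow> bool" where
  "subnormal _ B \<longleftrightarrow>
     closed_operator B \<and>
     (\<exists>(V :: 'a \<Rightarrow> 'l) S.
        clinear_map V \<and> (\<forall>x y. cinner (V x) (V y) = cinner x y) \<and>
        normal S \<and> {(V x, V y) | x y. (x, y) \<in> B} \<subseteq> S)"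

definition op_restrict :: "('a \<times> 'a) set \<Rightarrow> 'a set \<Rightarrow> ('a \<times> 'a) set" where
  "op_restrict T M = {(x, y). (x, y) \<in> T \<and> x \<in> M \<and> y \<in> M}"

definition invariant_under :: "'a set \<Rightarrow> ('a \<times> 'a) set \<Rightarrow> bool" where
  "invariant_under M T \<longleftrightarrow> (\<forall>x y. (x, y) \<in> T \<longrightarrow> x \<in> M \<longrightarrow> y \<in> M)"

definition reduces :: "'a::complex_inner set \<Rightarrow> ('a \<times> 'a) set \<Rightarrow> bool" where
  "reduces M T \<longleftrightarrow> invariant_under M T \<and> invariant_under (ortho_compl M) T"

end

theory Submission
  imports Defs "HOL-Complex_Analysis.Cauchy_Integral_Formula"
begin

text \<open>
  The heart is the case of a normal \<open>N\<close> and an \<open>M\<close>-hyponormal \<open>T\<close> with \<open>XN \<subseteq> TX\<close>.  The defect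
  \<open>d = T\<^sup>*X - XN\<^sup>*\<close> equals \<open>(T - z)\<^sup>*X - X(N - z)\<^sup>*\<close> for every \<open>z\<close>, so \<open>M\<close>-hyponormality and
  normality give \<open>\<parallel>d x\<parallel> \<le> C \<parallel>(N - z)x\<parallel>\<close> with \<open>C\<close> independent of \<open>z\<close>.  A functional with this bound
  vanishes: it can be divided boundedly by \<open>N - z\<close> for all \<open>z\<close>, and pairing the quotients yields bounded
  entire functions, to which Liouville's theorem applies.  This replaces the spectral theorem.

  A subnormal \<open>B\<close> reduces to this case by composing \<open>A\<close> with the projection onto the original
  space, the adjoint of a normal extension being normal; the second alternative is the first one
  for \<open>A\<^sup>*\<close>.  Both \<open>AA\<^sup>*\<close> and \<open>A\<^sup>*A\<close> then commute with the operators, hence so do the range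
  projections, and the parts are normal because \<open>(1 + T\<^sup>*T)\<^sup>-\<^sup>1\<close> and \<open>(1 + TT\<^sup>*)\<^sup>-\<^sup>1\<close> agree on the
  range, where they are computed from those of \<open>N\<close>.
\<close>

section \<open>The complex inner product\<close>

lemma cinner_add_right: "cinner x (y + z) = cinner x y + cinner x (z::'a::complex_inner)"
  by (metis cinner_add_left cinner_commute complex_cnj_add)

lemma cinner_scaleC_right: "cinner x (c *\<^sub>C y) = cnj c * cinner x (y::'a::complex_inner)"
  by (metis cinner_commute cinner_scaleC_left complex_cnj_mult)

lemma norm_scaleC: "norm (c *\<^sub>C x) = cmod c * norm (x::'a::complex_inner)"
proof -
  have "complex_of_real ((norm (c *\<^sub>C x))\<^sup>2) = (c * cnj c) * cinner x x"
    unfolding cinner_self[symmetric] cinner_scaleC_left cinner_scaleC_right by simp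
  also have "\<dots> = complex_of_real ((cmod c)\<^sup>2) * complex_of_real ((norm x)\<^sup>2)"
    unfolding complex_norm_square cinner_self ..
  also have "\<dots> = complex_of_real ((cmod c * norm x)\<^sup>2)"
    by (simp add: power_mult_distrib)
  finally have "complex_of_real ((norm (c *\<^sub>C x))\<^sup>2) = complex_of_real ((cmod c * norm x)\<^sup>2)" .
  then have "(norm (c *\<^sub>C x))\<^sup>2 = (cmod c * norm x)\<^sup>2"
    using of_real_eq_iff by blast
  then show ?thesis
    by (simp add: power2_eq_iff_nonneg)
qed

text \<open>A unimodular factor turns \<open>cinner x y\<close> into its modulus, after which the
  real inequality applies.\<close>

lemma cinner_Cauchy_Schwarz: "cmod (cinner x y) \<le> norm x * norm (y::'a::complex_inner)"
proof (cases "cinner x y = 0")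
  case False
  define c where "c = cnj (sgn (cinner x y))"
  have "c * cinner x y = (cinner x y * cnj (cinner x y)) / cmod (cinner x y)"
    by (simp add: c_def sgn_eq)
  also have "\<dots> = cmod (cinner x y)"
    using False by (simp add: complex_norm_square[symmetric] power2_eq_square)
  finally have "c * cinner x y = cmod (cinner x y)" .
  then have "cmod (cinner x y) = inner (c *\<^sub>C x) y"
    by (simp add: inner_eq_Re_cinner cinner_scaleC_left)
  also have "\<dots> \<le> norm (c *\<^sub>C x) * norm y"
    by (rule norm_cauchy_schwarz)
  also have "\<dots> = norm x * norm y"
    using False by (simp add: norm_scaleC c_def norm_sgn)
  finally show ?thesis .
qed auto

interpretation cinner: bounded_bilinear "cinner :: 'a::complex_inner \<Rightarrow> 'a \<Rightarrow> complex"
proof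
  show "\<exists>K. \<forall>a b::'a. cmod (cinner a b) \<le> norm a * norm b * K"
    by (rule exI[of _ 1]) (simp add: cinner_Cauchy_Schwarz)
qed (simp_all add: cinner_add_left cinner_add_right scaleR_scaleC cinner_scaleC_left
      cinner_scaleC_right scaleC_complex_def)

lemma bounded_linear_scaleC: "bounded_linear (\<lambda>x::'a::complex_inner. c *\<^sub>C x)"
  by (rule bounded_linear_intro[where K = "cmod c"])
    (simp_all add: scaleC_add_right scaleR_scaleC scaleC_scaleC norm_scaleC mult.commute)

lemmas tendsto_scaleC = bounded_linear.tendsto[OF bounded_linear_scaleC]

lemmas scaleC_diff_right = complex_vector.scale_right_diff_distrib

section \<open>Complex subspaces, their closures, and domains of graphs\<close>

lemma subspace_if_csubspace: "csubspace M \<Longrightarrow> subspace M"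
  by (simp add: complex_vector.subspace_def subspace_def scaleR_scaleC)

lemma subspace_closure:
  fixes M :: "'a::real_normed_vector set"
  assumes "subspace M"
  shows "subspace (closure M)"
  unfolding subspace_def
proof (intro conjI ballI allI)
  show "0 \<in> closure M"
    using assms subspace_0 closure_subset by blast
next
  fix x y assume "x \<in> closure M" "y \<in> closure M"
  then obtain f g where "\<And>n. f n \<in> M" "f \<longlonglongrightarrow> x" "\<And>n. g n \<in> M" "g \<longlonglongrightarrow> y"
    unfolding closure_sequential by blast
  then have "\<And>n. f n + g n \<in> M" "(\<lambda>n. f n + g n) \<longlonglongrightarrow> x + y"
    by (auto intro: tendsto_add subspace_add assms)
  then show "x + y \<in> closure M"
    unfolding closure_sequential by (intro exI[of _ "\<lambda>n. f n + g n"]) simp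
next
  fix c x assume "x \<in> closure M"
  then obtain f where "\<And>n. f n \<in> M" "f \<longlonglongrightarrow> x"
    unfolding closure_sequential by blast
  then have "\<And>n. c *\<^sub>R f n \<in> M" "(\<lambda>n. c *\<^sub>R f n) \<longlonglongrightarrow> c *\<^sub>R x"
    by (auto intro: tendsto_scaleR subspace_scale assms)
  then show "c *\<^sub>R x \<in> closure M"
    unfolding closure_sequential by (intro exI[of _ "\<lambda>n. c *\<^sub>R f n"]) simp
qed

lemma csubspace_closure:
  fixes M :: "'a::complex_inner set"
  assumes "csubspace M"
  shows "csubspace (closure M)"
  unfolding complex_vector.subspace_def
proof (intro conjI ballI allI)
  show "0 \<in> closure M"
    using complex_vector.subspace_0[OF assms] closure_subset by blast
next
  fix x y assume "x \<in> closure M" "y \<in> closure M"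
  then show "x + y \<in> closure M"
    by (rule subspace_add[OF subspace_closure[OF subspace_if_csubspace[OF assms]]])
next
  fix c x assume "x \<in> closure M"
  then obtain f where f: "\<And>n. f n \<in> M" "f \<longlonglongrightarrow> x"
    unfolding closure_sequential by blast
  then have "\<And>n. c *\<^sub>C f n \<in> M" "(\<lambda>n. c *\<^sub>C f n) \<longlonglongrightarrow> c *\<^sub>C x"
    by (auto intro: tendsto_scaleC complex_vector.subspace_scale assms)
  then show "c *\<^sub>C x \<in> closure M"
    unfolding closure_sequential by (intro exI[of _ "\<lambda>n. c *\<^sub>C f n"]) simp
qed

lemma csubspace_Domain:
  fixes G :: "('a::complex_vector \<times> 'b::complex_vector) set"
  assumes "csubspace G"
  shows "csubspace (Domain G)"
  unfolding complex_vector.subspace_def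
proof (intro conjI ballI allI)
  show "0 \<in> Domain G"
    using complex_vector.subspace_0[OF assms] by (auto simp: zero_prod_def)
next
  fix x y assume "x \<in> Domain G" "y \<in> Domain G"
  then obtain u v where "(x, u) \<in> G" "(y, v) \<in> G" by blast
  then show "x + y \<in> Domain G"
    using complex_vector.subspace_add[OF assms, of "(x, u)" "(y, v)"] by auto
next
  fix c x assume "x \<in> Domain G"
  then obtain u where "(x, u) \<in> G" by blast
  then show "c *\<^sub>C x \<in> Domain G"
    using complex_vector.subspace_scale[OF assms, of "(x, u)" c] by (auto simp: scaleC_prod_def)
qed

text \<open>Real orthogonality to \<open>\<i> *\<^sub>C y\<close> is the vanishing of the imaginary
  part of \<open>cinner x y\<close>. This upgrades real projections to complex ones.\<close>

lemma cinner_eq_0_if_inner_eq_0: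
  fixes x :: "'a::complex_inner"
  assumes "csubspace M" "\<And>y. y \<in> M \<Longrightarrow> inner x y = 0" "y \<in> M"
  shows "cinner x y = 0"
proof -
  have "\<i> *\<^sub>C y \<in> M"
    using assms complex_vector.subspace_scale by blast
  then have "Re (cinner x (\<i> *\<^sub>C y)) = 0"
    using assms(2) by (metis inner_eq_Re_cinner)
  then show ?thesis
    using assms(2,3) by (simp add: cinner_scaleC_right complex_eq_iff inner_eq_Re_cinner)
qed

section \<open>Orthogonal projection and Riesz representation\<close>

text \<open>A minimizing sequence for the distance to \<open>M\<close> is Cauchy. Real scalars are
  used because the lemma is also applied to graphs in product spaces, which here carry
  \<open>inner\<close> but no \<open>cinner\<close>.\<close>

lemma orthogonal_projection_exists:
  fixes M :: "'a::{real_inner,complete_space} set"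
  assumes M: "subspace M" "closed M"
  shows "\<exists>m\<in>M. \<forall>y\<in>M. inner (x - m) y = 0"
proof -
  define d where "d = (INF m\<in>M. (norm (x - m))\<^sup>2)"
  have bdd: "bdd_below ((\<lambda>m. (norm (x - m))\<^sup>2) ` M)"
    by (rule bdd_belowI[where m = 0]) auto
  have ne: "M \<noteq> {}"
    using M(1) subspace_0 by blast
  have d_le: "d \<le> (norm (x - m))\<^sup>2" if "m \<in> M" for m
    unfolding d_def by (rule cINF_lower[OF bdd that])
  have "\<exists>m\<in>M. (norm (x - m))\<^sup>2 < d + inverse (real (Suc n))" for n
    using cINF_less_iff[OF ne bdd, of "d + inverse (real (Suc n))"] by (simp add: d_def)
  then obtain m where m: "\<And>n. m n \<in> M" "\<And>n. (norm (x - m n))\<^sup>2 < d + inverse (real (Suc n))"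
    by metis
  have close: "(norm (m i - m j))\<^sup>2 \<le> 2 * inverse (real (Suc i)) + 2 * inverse (real (Suc j))" for i j
  proof -
    have "(1/2) *\<^sub>R (m i + m j) \<in> M"
      using M(1) m(1) by (simp add: subspace_add subspace_scale)
    from d_le[OF this] have "4 * d \<le> 4 * (norm (x - (1/2) *\<^sub>R (m i + m j)))\<^sup>2"
      by simp
    \<comment> \<open>Parallelogram law for \<open>x - m i\<close> and \<open>x - m j\<close>; the
      midpoint lies in \<open>M\<close>, so \<open>d\<close> bounds its squared distance from
      below.\<close>
    moreover have "(norm (m i - m j))\<^sup>2 + 4 * (norm (x - (1/2) *\<^sub>R (m i + m j)))\<^sup>2
      = 2 * (norm (x - m i))\<^sup>2 + 2 * (norm (x - m j))\<^sup>2"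
      by (simp add: power2_norm_eq_inner inner_simps algebra_simps inner_commute)
    ultimately show ?thesis
      using m(2)[of i] m(2)[of j] by linarith
  qed
  have "Cauchy m"
  proof (rule metric_CauchyI)
    fix e :: real assume "e > 0"
    then obtain k where k: "inverse (real (Suc k)) < e\<^sup>2 / 4"
      using reals_Archimedean[of "e\<^sup>2 / 4"] by auto
    have "dist (m i) (m j) < e" if "i \<ge> k" "j \<ge> k" for i j
    proof -
      have "inverse (real (Suc i)) \<le> inverse (real (Suc k))"
        "inverse (real (Suc j)) \<le> inverse (real (Suc k))"
        using that by (simp_all add: le_imp_inverse_le)
      then have "(norm (m i - m j))\<^sup>2 < e\<^sup>2"
        using close[of i j] k by linarith
      then show ?thesis
        using \<open>e > 0\<close> by (simp add: dist_norm power2_less_imp_less)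
    qed
    then show "\<exists>k. \<forall>i\<ge>k. \<forall>j\<ge>k. dist (m i) (m j) < e" by blast
  qed
  then obtain p where p: "m \<longlonglongrightarrow> p"
    using Cauchy_convergent convergent_def by blast
  have "p \<in> M"
    using M(2) m(1) p closed_sequentially by blast
  have "(\<lambda>n. d + inverse (real (Suc n))) \<longlonglongrightarrow> d"
    using tendsto_add[OF tendsto_const LIMSEQ_inverse_real_of_nat, of d] by simp
  moreover have "(\<lambda>n. (norm (x - m n))\<^sup>2) \<longlonglongrightarrow> (norm (x - p))\<^sup>2"
    by (intro tendsto_intros p)
  ultimately have p_le: "(norm (x - p))\<^sup>2 \<le> d"
    using LIMSEQ_le m(2) less_imp_le by meson
  have "inner (x - p) y = 0" if "y \<in> M" for y
  proof (rule ccontr)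
    assume nz: "inner (x - p) y \<noteq> 0"
    then have y: "inner y y > 0" by auto
    \<comment> \<open>The real \<open>t\<close> for which \<open>p + t *\<^sub>R y\<close> is
      closest to \<open>x\<close>.\<close>
    define t where "t = inner (x - p) y / inner y y"
    have "d \<le> (norm (x - (p + t *\<^sub>R y)))\<^sup>2"
      using M(1) \<open>p \<in> M\<close> that by (intro d_le) (simp add: subspace_add subspace_scale)
    also have "\<dots> = (norm (x - p))\<^sup>2 - 2 * t * inner (x - p) y + t * t * inner y y"
      by (simp add: power2_norm_eq_inner inner_simps algebra_simps inner_commute)
    also have "\<dots> = (norm (x - p))\<^sup>2 - (inner (x - p) y)\<^sup>2 / inner y y"
      using y by (simp add: t_def field_simps power2_eq_square)
    also have "\<dots> < d"
      using p_le nz y by (smt (verit) divide_pos_pos zero_less_power2)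
    finally show False by simp
  qed
  then show ?thesis using \<open>p \<in> M\<close> by blast
qed

lemma complex_orthogonal_projection_exists:
  fixes M :: "'a::complex_hilbert set"
  assumes "csubspace M" "closed M"
  shows "\<exists>m\<in>M. \<forall>y\<in>M. cinner (x - m) y = 0"
  using orthogonal_projection_exists[OF subspace_if_csubspace, OF assms, of x]
    cinner_eq_0_if_inner_eq_0[OF assms(1)] by blast

text \<open>The functional is given by its graph, so no extension to the closure of its domain is
  needed: the representing vector is read off the component of \<open>(0, 1)\<close> orthogonal to the graph.\<close>

lemma riesz_representation:
  fixes G :: "('a::complex_hilbert \<times> complex) set"
  assumes G: "csubspace G" and "0 \<le> c" and bound: "\<And>r l. (r, l) \<in> G \<Longrightarrow> cmod l \<le> c * norm r"
  shows "\<exists>f \<in> closure (Domain G). norm f \<le> c \<and> (\<forall>(r, l) \<in> G. l = cinner r f)"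
proof -
  have sub: "subspace (closure G)"
    using G by (simp add: subspace_if_csubspace subspace_closure)
  then obtain m where m: "m \<in> closure G" "\<And>y. y \<in> closure G \<Longrightarrow> inner ((0, 1) - m) y = 0"
    using orthogonal_projection_exists[OF sub, of "(0, 1)"] by auto
  obtain a \<alpha> where a: "m = (a, \<alpha>)" by fastforce
  have closure_bound: "cmod (snd p) \<le> c * norm (fst p)" if "p \<in> closure G" for p
  proof -
    obtain s where s: "\<And>n. s n \<in> G" "s \<longlonglongrightarrow> p"
      using \<open>p \<in> closure G\<close> unfolding closure_sequential by blast
    have "(\<lambda>n. cmod (snd (s n))) \<longlonglongrightarrow> cmod (snd p)" "(\<lambda>n. c * norm (fst (s n))) \<longlonglongrightarrow> c * norm (fst p)"
      by (intro tendsto_intros s(2))+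
    then show ?thesis
      by (rule LIMSEQ_le) (use s(1) bound in \<open>metis prod.collapse\<close>)
  qed
  have orth_Re: "Re (cinner r a) = Re ((1 - \<alpha>) * cnj l)" if "(r, l) \<in> G" for r l
  proof -
    have "inner ((0, 1) - m) (r, l) = 0"
      using that m(2) closure_subset by blast
    then have "inner r a = Re ((1 - \<alpha>) * cnj l)"
      by (simp add: a inner_complex_def inner_commute[of r a])
    then show ?thesis
      by (simp add: inner_eq_Re_cinner)
  qed
  have orth: "cinner r a = cnj (1 - \<alpha>) * l" if "(r, l) \<in> G" for r l
  proof (rule complex_eqI)
    show "Re (cinner r a) = Re (cnj (1 - \<alpha>) * l)"
      using orth_Re[OF that] by simp
    \<comment> \<open>Orthogonality in the product space is real, so the imaginary part comes from
      the multiple by \<open>\<i>\<close>.\<close>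
    have "(\<i> *\<^sub>C r, \<i> * l) \<in> G"
      using complex_vector.subspace_scale[OF G that, of \<i>]
      by (simp add: scaleC_prod_def scaleC_complex_def)
    from orth_Re[OF this] show "Im (cinner r a) = Im (cnj (1 - \<alpha>) * l)"
      by (simp add: cinner_scaleC_left algebra_simps)
  qed
  \<comment> \<open>Otherwise \<open>(0, 1)\<close> itself would lie in the closure of
    \<open>G\<close>, contrary to the bound.\<close>
  have "\<alpha> \<noteq> 1"
  proof
    assume 1: "\<alpha> = 1"
    have "inner ((0, 1) - m) m = 0"
      using m by blast
    then have "a = 0" using 1 by (simp add: a)
    then show False
      using closure_bound[OF m(1)] 1 by (simp add: a)
  qed
  define f where "f = (1 / (1 - \<alpha>)) *\<^sub>C a"
  have "a \<in> closure (Domain G)"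
  proof -
    have "fst ` closure G \<subseteq> closure (fst ` G)"
      by (rule image_closure_subset) (auto intro!: continuous_on_fst continuous_on_id closure_subset[THEN subsetD])
    moreover have "a \<in> fst ` closure G"
      using m(1) a image_iff by fastforce
    ultimately show ?thesis
      unfolding fst_eq_Domain by blast
  qed
  then have f: "f \<in> closure (Domain G)"
    unfolding f_def using complex_vector.subspace_scale[OF csubspace_closure[OF csubspace_Domain[OF G]]] by blast
  have rep: "l = cinner r f" if "(r, l) \<in> G" for r l
    using orth[OF that] \<open>\<alpha> \<noteq> 1\<close> by (simp add: f_def cinner_scaleC_right)
  \<comment> \<open>The bound concerns elements of the domain; along a sequence tending to
    \<open>f\<close> it becomes \<open>norm f * norm f \<le> c * norm f\<close>.\<close>
  obtain s where s: "\<And>n. s n \<in> Domain G" "s \<longlonglongrightarrow> f"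
    using f unfolding closure_sequential by blast
  have "(\<lambda>n. cmod (cinner (s n) f)) \<longlonglongrightarrow> cmod (cinner f f)" "(\<lambda>n. c * norm (s n)) \<longlonglongrightarrow> c * norm f"
    by (intro tendsto_intros cinner.tendsto s(2))+
  then have "cmod (cinner f f) \<le> c * norm f"
    by (rule LIMSEQ_le) (use s(1) bound rep in blast)
  then have "norm f * norm f \<le> c * norm f"
    by (simp add: cinner_self norm_mult power2_eq_square)
  then have "norm f \<le> c"
    using \<open>0 \<le> c\<close> by (cases "norm f = 0") auto
  then show ?thesis using f rep by blast
qed

section \<open>Bounded operators and their adjoints\<close>

lemma clinear_mapD:
  assumes "clinear_map f"
  shows "f (x + y) = f x + f y" "f (c *\<^sub>C x) = c *\<^sub>C f x"
    "f 0 = 0" "f (x - y) = f x - f y"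
proof -
  show *: "\<And>x y. f (x + y) = f x + f y" "\<And>c x. f (c *\<^sub>C x) = c *\<^sub>C f x"
    using assms by (auto simp: clinear_map_def)
  show "f 0 = 0"
    using *(1)[of 0 0] by simp
  show "f (x - y) = f x - f y"
    using *(1)[of "x - y" y] by simp
qed

lemma bounded_clinear_map_clinear: "bounded_clinear_map f \<Longrightarrow> clinear_map f"
  by (simp add: bounded_clinear_map_def)

lemmas bounded_clinear_mapD = clinear_mapD[OF bounded_clinear_map_clinear]

lemma bounded_clinear_map_bound:
  assumes "bounded_clinear_map f"
  obtains c where "c > 0" "\<And>x. norm (f x) \<le> c * norm x"
proof -
  obtain c where "\<And>x. norm (f x) \<le> c * norm x"
    using assms by (auto simp: bounded_clinear_map_def)
  then have "norm (f x) \<le> max c 1 * norm x" for x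
    by (meson max.cobounded1 mult_right_mono norm_ge_zero order_trans)
  then show thesis
    using that[of "max c 1"] by simp
qed

lemma bounded_clinear_map_bounded_linear:
  assumes "bounded_clinear_map f"
  shows "bounded_linear f"
proof -
  obtain c where "c > 0" "\<And>x. norm (f x) \<le> c * norm x"
    using assms bounded_clinear_map_bound by blast
  then show ?thesis
    by (intro bounded_linear_intro[where K = c])
      (simp_all add: scaleR_scaleC bounded_clinear_mapD[OF assms] mult.commute)
qed

lemmas bounded_clinear_map_tendsto = bounded_linear.tendsto[OF bounded_clinear_map_bounded_linear]

lemma bounded_clinear_map_compose:
  assumes "bounded_clinear_map f" "bounded_clinear_map g"
  shows "bounded_clinear_map (\<lambda>x. f (g x))"
proof -
  obtain c d where c: "c > 0" "\<And>x. norm (f x) \<le> c * norm x" and d: "\<And>x. norm (g x) \<le> d * norm x"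
    using assms bounded_clinear_map_bound by metis
  have "norm (f (g x)) \<le> c * d * norm x" for x
    using order_trans[OF c(2)[of "g x"] mult_left_mono[OF d[of x], of c]] c(1) by (simp add: mult.assoc)
  then show ?thesis
    using assms unfolding bounded_clinear_map_def clinear_map_def by auto
qed

lemma ext_cinner:
  fixes x :: "'a::complex_inner"
  assumes "\<And>v. cinner v x = cinner v y"
  shows "x = y"
proof -
  have "cinner (x - y) (x - y) = 0"
    by (simp add: assms cinner.diff_right)
  then show ?thesis by (simp add: cinner_self)
qed

text \<open>A symmetric relation instead of an adjoint function, so that every lemma about
  \<open>A\<close> also serves \<open>A'\<close>.\<close>

definition adjoint_pair where
  "adjoint_pair A A' \<longleftrightarrow> bounded_clinear_map A \<and> bounded_clinear_map A' \<and>
    (\<forall>x y. cinner (A x) y = cinner x (A' y))"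

lemma adjoint_pairD: "adjoint_pair A A' \<Longrightarrow> cinner (A x) y = cinner x (A' y)"
  by (simp add: adjoint_pair_def)

lemma adjoint_pair_sym:
  assumes "adjoint_pair A A'"
  shows "adjoint_pair A' A"
proof -
  have "cinner (A' x) y = cinner x (A y)" for x y
    using adjoint_pairD[OF assms, of y x] by (metis cinner_commute)
  with assms show ?thesis by (simp add: adjoint_pair_def)
qed

text \<open>Riesz representation of the functional \<open>\<lambda>x. cinner (A x) y\<close>,
  bounded by \<open>c * norm y\<close>.\<close>

lemma adjoint_exists:
  fixes A :: "'a::complex_hilbert \<Rightarrow> 'b::complex_hilbert"
  assumes A: "bounded_clinear_map A"
  obtains A' where "adjoint_pair A A'"
proof -
  obtain c where c: "c > 0" "\<And>x. norm (A x) \<le> c * norm x"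
    using A bounded_clinear_map_bound by blast
  have "\<exists>f. norm f \<le> c * norm y \<and> (\<forall>x. cinner (A x) y = cinner x f)" for y
  proof -
    let ?G = "{(x, cinner (A x) y) | x. True}"
    have "csubspace ?G"
      unfolding complex_vector.subspace_def
      by (auto simp: scaleC_prod_def zero_prod_def bounded_clinear_mapD[OF A] cinner_add_left
          cinner_scaleC_left scaleC_complex_def cinner.zero_left)
    moreover have "cmod l \<le> (c * norm y) * norm r" if "(r, l) \<in> ?G" for r l
    proof -
      have "cmod l \<le> norm (A r) * norm y"
        using that cinner_Cauchy_Schwarz by auto
      also have "\<dots> \<le> (c * norm r) * norm y"
        by (intro mult_right_mono c) simp
      finally show ?thesis by (simp add: mult_ac)
    qed
    ultimately show ?thesis
      using riesz_representation[of ?G "c * norm y"] c(1) by fastforce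
  qed
  then obtain A' where A': "\<And>y. norm (A' y) \<le> c * norm y" "\<And>x y. cinner (A x) y = cinner x (A' y)"
    by metis
  have "A' (x + y) = A' x + A' y" for x y
    by (rule ext_cinner) (simp add: cinner_add_right A'(2)[symmetric])
  moreover have "A' (z *\<^sub>C x) = z *\<^sub>C A' x" for z x
    by (rule ext_cinner) (simp add: cinner_scaleC_right A'(2)[symmetric])
  ultimately have "bounded_clinear_map A'"
    using A'(1) unfolding bounded_clinear_map_def clinear_map_def by blast
  then show thesis
    using that A A'(2) unfolding adjoint_pair_def by blast
qed

lemma op_adj_op_of:
  assumes "adjoint_pair A A'"
  shows "op_adj (op_of A) = op_of A'"
proof -
  have "w = A' y" if "\<forall>x. cinner (A x) y = cinner x w" for y w
    using that adjoint_pairD[OF assms] by (metis ext_cinner)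
  then show ?thesis
    using adjoint_pairD[OF assms] unfolding adjoint_in_def op_of_def by auto
qed

section \<open>Unbounded operators\<close>

lemma op_adj_iff: "(y, w) \<in> op_adj T \<longleftrightarrow> (\<forall>x v. (x, v) \<in> T \<longrightarrow> cinner v y = cinner x w)"
  by (auto simp: adjoint_in_def)

lemma op_adjD: "(y, w) \<in> op_adj T \<Longrightarrow> (x, v) \<in> T \<Longrightarrow> cinner v y = cinner x w"
  by (simp add: op_adj_iff)

lemma linear_operatorD:
  assumes "linear_operator T"
  shows "(0, 0) \<in> T" "(x, y) \<in> T \<Longrightarrow> (x', y') \<in> T \<Longrightarrow> (x + x', y + y') \<in> T"
    "(x, y) \<in> T \<Longrightarrow> (c *\<^sub>C x, c *\<^sub>C y) \<in> T"
    "(x, y) \<in> T \<Longrightarrow> (x', y') \<in> T \<Longrightarrow> (x - x', y - y') \<in> T"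
    "(x, y) \<in> T \<Longrightarrow> (x, z) \<in> T \<Longrightarrow> y = z"
proof -
  have T: "csubspace T" "single_valued T"
    using assms by (auto simp: linear_operator_def)
  show "(0, 0) \<in> T"
    using complex_vector.subspace_0[OF T(1)] by (simp add: zero_prod_def)
  show "(x, y) \<in> T \<Longrightarrow> (x', y') \<in> T \<Longrightarrow> (x + x', y + y') \<in> T"
    using complex_vector.subspace_add[OF T(1), of "(x, y)" "(x', y')"] by simp
  show "(x, y) \<in> T \<Longrightarrow> (c *\<^sub>C x, c *\<^sub>C y) \<in> T"
    using complex_vector.subspace_scale[OF T(1), of "(x, y)" c] by (simp add: scaleC_prod_def)
  show "(x, y) \<in> T \<Longrightarrow> (x', y') \<in> T \<Longrightarrow> (x - x', y - y') \<in> T"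
    using complex_vector.subspace_diff[OF T(1), of "(x, y)" "(x', y')"] by simp
  show "(x, y) \<in> T \<Longrightarrow> (x, z) \<in> T \<Longrightarrow> y = z"
    using T(2) by (auto dest: single_valuedD)
qed

lemma closed_operator_linear: "closed_operator T \<Longrightarrow> linear_operator T"
  by (simp add: closed_operator_def)

lemmas closed_operatorD = linear_operatorD[OF closed_operator_linear]

lemma closed_operator_tendsto:
  assumes "closed_operator T" "\<And>n. (f n, g n) \<in> T" "f \<longlonglongrightarrow> x" "g \<longlonglongrightarrow> y"
  shows "(x, y) \<in> T"
proof -
  have "(\<lambda>n. (f n, g n)) \<longlonglongrightarrow> (x, y)"
    using assms by (intro tendsto_Pair)
  then show ?thesis
    using assms(1,2) closed_sequentially[of T "\<lambda>n. (f n, g n)"] by (simp add: closed_operator_def)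
qed

lemma orthogonal_to_dense:
  assumes "densely_defined T" "\<And>x y. (x, y) \<in> T \<Longrightarrow> cinner x v = 0"
  shows "v = 0"
proof -
  obtain f where f: "\<And>n. f n \<in> Domain T" "f \<longlonglongrightarrow> v"
    using assms(1) unfolding densely_defined_in_def closure_sequential[symmetric]
    by (metis UNIV_I closure_sequential subset_iff)
  have "(\<lambda>n. cinner (f n) v) \<longlonglongrightarrow> cinner v v"
    by (intro cinner.tendsto f tendsto_const)
  moreover have "cinner (f n) v = 0" for n
    using assms(2) f(1)[of n] by blast
  ultimately have "cinner v v = 0"
    by (simp add: LIMSEQ_const_iff)
  then show ?thesis by (simp add: cinner_self)
qed

lemma densely_definedI:
  fixes T :: "('a::complex_hilbert \<times> 'b::complex_vector) set"
  assumes "csubspace T" "\<And>v. (\<And>x y. (x, y) \<in> T \<Longrightarrow> cinner x v = 0) \<Longrightarrow> v = 0"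
  shows "densely_defined T"
proof -
  have "v \<in> closure (Domain T)" for v
  proof -
    obtain m where m: "m \<in> closure (Domain T)" "\<forall>y\<in>closure (Domain T). cinner (v - m) y = 0"
      using complex_orthogonal_projection_exists[OF csubspace_closure[OF csubspace_Domain[OF assms(1)]] closed_closure] by blast
    have "cinner x (v - m) = 0" if "(x, y) \<in> T" for x y
    proof -
      have "cinner (v - m) x = 0"
        using m(2) that closure_subset by blast
      then show ?thesis by (metis cinner_commute complex_cnj_zero)
    qed
    then have "v - m = 0" by (rule assms(2))
    then show ?thesis using m(1) by simp
  qed
  then show ?thesis by (auto simp: densely_defined_in_def)
qed

lemma op_adj_closed_operator:
  fixes T :: "('a::complex_hilbert \<times> 'b::complex_hilbert) set"
  assumes "densely_defined T"
  shows "closed_operator (op_adj T)"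
proof -
  have "csubspace (op_adj T)"
    unfolding complex_vector.subspace_def
    by (auto simp: adjoint_in_def cinner_add_right cinner_scaleC_right scaleC_prod_def zero_prod_def
        cinner.zero_right; fastforce)
  moreover have "single_valued (op_adj T)"
  proof (rule single_valuedI)
    fix y w w' assume "(y, w) \<in> op_adj T" "(y, w') \<in> op_adj T"
    then have "cinner x (w - w') = 0" if "(x, v) \<in> T" for x v
      using that op_adjD by (metis cinner.diff_right eq_iff_diff_eq_0)
    then show "w = w'"
      using orthogonal_to_dense[OF assms] by (metis eq_iff_diff_eq_0)
  qed
  moreover have "closed (op_adj T)"
    unfolding closed_sequential_limits
  proof (intro allI impI, elim conjE)
    fix s l assume s: "\<forall>n. s n \<in> op_adj T" "s \<longlonglongrightarrow> l"
    have "cinner v (fst l) = cinner x (snd l)" if "(x, v) \<in> T" for x v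
    proof (rule LIMSEQ_unique)
      show "(\<lambda>n. cinner v (fst (s n))) \<longlonglongrightarrow> cinner v (fst l)"
        by (intro cinner.tendsto tendsto_fst s tendsto_const)
      have "cinner v (fst (s n)) = cinner x (snd (s n))" for n
        using s(1) that op_adjD by (metis prod.collapse)
      then show "(\<lambda>n. cinner v (fst (s n))) \<longlonglongrightarrow> cinner x (snd l)"
        by (simp add: cinner.tendsto tendsto_snd s)
    qed
    then show "l \<in> op_adj T"
      by (metis op_adj_iff prod.collapse)
  qed
  ultimately show ?thesis
    by (simp add: closed_operator_def linear_operator_def)
qed

text \<open>The product space is the orthogonal sum of the graph of \<open>T\<close> and the rotated
  graph of its adjoint: projecting \<open>(u, v)\<close> onto \<open>T\<close> leaves the residue
  \<open>(- w, y)\<close>.\<close>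

lemma graph_decomposition:
  assumes "closed_operator T"
  shows "\<exists>x t y w. (x, t) \<in> T \<and> (y, w) \<in> op_adj T \<and> u = x - w \<and> v = t + y"
proof -
  have sub: "csubspace T" and cl: "closed T"
    using assms by (auto simp: closed_operator_def linear_operator_def)
  obtain m where m: "m \<in> T" "\<And>p. p \<in> T \<Longrightarrow> inner ((u, v) - m) p = 0"
    using orthogonal_projection_exists[OF subspace_if_csubspace[OF sub] cl, of "(u, v)"] by blast
  obtain x t where xt: "m = (x, t)" by fastforce
  have Re: "Re (cinner x' (u - x)) + Re (cinner t' (v - t)) = 0" if "(x', t') \<in> T" for x' t'
    using m(2)[OF that] by (simp add: xt inner_eq_Re_cinner[symmetric] inner_commute)
  have "cinner t' (v - t) = cinner x' (x - u)" if "(x', t') \<in> T" for x' t'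
  proof -
    have "(\<i> *\<^sub>C x', \<i> *\<^sub>C t') \<in> T"
      using that closed_operatorD(3)[OF assms] by blast
    from Re[OF this] Re[OF that] have "cinner x' (u - x) + cinner t' (v - t) = 0"
      by (simp add: cinner_scaleC_left complex_eq_iff)
    then show ?thesis
      by (simp add: cinner.diff_right algebra_simps)
  qed
  then have "(v - t, x - u) \<in> op_adj T"
    by (simp add: op_adj_iff)
  then show ?thesis
    using m(1) xt by (intro exI[of _ x] exI[of _ t] exI[of _ "v - t"] exI[of _ "x - u"]) simp
qed

lemma subset_op_adj_op_adj: "T \<subseteq> op_adj (op_adj T)"
proof
  fix p assume "p \<in> T"
  then show "p \<in> op_adj (op_adj T)"
    by (cases p) (simp add: op_adj_iff, metis cinner_commute)
qed

text \<open>\<open>graph_decomposition\<close> splits a pair of the second adjoint; its component in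
  the rotated adjoint graph is orthogonal to itself.\<close>

lemma op_adj_op_adj:
  assumes T: "closed_operator T"
  shows "op_adj (op_adj T) = T"
proof
  show "op_adj (op_adj T) \<subseteq> T"
  proof
    fix p assume "p \<in> op_adj (op_adj T)"
    then obtain a b where ab: "p = (a, b)" "(a, b) \<in> op_adj (op_adj T)" by (cases p) auto
    obtain x t y w where *: "(x, t) \<in> T" "(y, w) \<in> op_adj T" "a = x - w" "b = t + y"
      using graph_decomposition[OF T] by blast
    have "cinner w a = cinner y b" "cinner w x = cinner y t"
      using ab * subset_op_adj_op_adj op_adjD by blast+
    then have "cinner w w + cinner y y = 0"
      by (simp add: *(3,4) cinner.diff_right cinner_add_right neg_eq_iff_add_eq_0)
    then have "complex_of_real ((norm w)\<^sup>2 + (norm y)\<^sup>2) = 0"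
      by (simp add: cinner_self)
    then have "(norm w)\<^sup>2 + (norm y)\<^sup>2 = 0"
      using of_real_eq_0_iff by blast
    then have "w = 0 \<and> y = 0"
      by (simp add: sum_power2_eq_zero_iff)
    with * ab show "p \<in> T" by simp
  qed
qed (rule subset_op_adj_op_adj)

text \<open>A vector \<open>v\<close> orthogonal to the domain of the adjoint puts
  \<open>(0, v)\<close> into the second adjoint, which is the single-valued
  \<open>T\<close>.\<close>

lemma op_adj_densely_defined:
  assumes "closed_operator T" "densely_defined T"
  shows "densely_defined (op_adj T)"
proof (rule densely_definedI)
  show "csubspace (op_adj T)"
    using op_adj_closed_operator[OF assms(2)] by (simp add: closed_operator_def linear_operator_def)
  fix v assume v: "\<And>x y. (x, y) \<in> op_adj T \<Longrightarrow> cinner x v = 0"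
  have "(0, v) \<in> op_adj (op_adj T)"
    unfolding op_adj_iff[of 0] by (simp add: cinner.zero_right v)
  then show "v = 0"
    using assms(1) closed_operatorD(1,5) op_adj_op_adj by blast
qed

section \<open>Intertwining relations and their adjoints\<close>

definition intertwines where
  "intertwines A S T \<longleftrightarrow> (\<forall>x y. (x, y) \<in> S \<longrightarrow> (A x, A y) \<in> T)"

lemma intertwinesD: "intertwines A S T \<Longrightarrow> (x, y) \<in> S \<Longrightarrow> (A x, A y) \<in> T"
  by (simp add: intertwines_def)

lemma op_comp_subset_iff: "op_of A \<circ>\<^sub>o S \<subseteq> T \<circ>\<^sub>o op_of A \<longleftrightarrow> intertwines A S T"
  by (auto simp: op_comp_def op_of_def intertwines_def)

lemma intertwines_adjoint:
  assumes "adjoint_pair A A'" "intertwines A S T"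
  shows "intertwines A' (op_adj T) (op_adj S)"
  unfolding intertwines_def
proof (intro allI impI)
  fix x y assume xy: "(x, y) \<in> op_adj T"
  have "cinner v (A' x) = cinner u (A' y)" if "(u, v) \<in> S" for u v
    using op_adjD[OF xy intertwinesD[OF assms(2) that]] by (simp add: adjoint_pairD[OF assms(1)])
  then show "(A' x, A' y) \<in> op_adj S"
    by (simp add: op_adj_iff)
qed

lemma intertwines_compose:
  "intertwines A S T \<Longrightarrow> intertwines C R S \<Longrightarrow> intertwines (\<lambda>x. A (C x)) R T"
  by (simp add: intertwines_def)

section \<open>The resolvent \<open>(1 + T\<^sup>*T)\<^sup>-\<^sup>1\<close>\<close>

text \<open>Relational form of \<open>x = (1 + T\<^sup>*T)\<^sup>-\<^sup>1 u\<close> and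
  \<open>t = T x\<close>: the second condition says that
  \<open>T\<^sup>*T x = u - x\<close>.\<close>

definition resolvent_triple where
  "resolvent_triple T u x t \<longleftrightarrow> (x, t) \<in> T \<and> (t, u - x) \<in> op_adj T"

text \<open>In the decomposition of \<open>(u, 0)\<close> along the graph of \<open>T\<close> and
  the rotated adjoint graph, \<open>y = - t\<close> and \<open>- w = u - x\<close>.\<close>

lemma resolvent_triple_exists:
  assumes "closed_operator T" "densely_defined T"
  shows "\<exists>x t. resolvent_triple T u x t"
proof -
  obtain x t y w where *: "(x, t) \<in> T" "(y, w) \<in> op_adj T" "u = x - w" "0 = t + y"
    using graph_decomposition[OF assms(1)] by blast
  then have "(- 1) *\<^sub>C y = t" "(- 1) *\<^sub>C w = u - x"
    by (simp_all add: complex_vector.scale_minus_left scaleC_one minus_unique add.commute)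
  then have "(t, u - x) \<in> op_adj T"
    using closed_operatorD(3)[OF op_adj_closed_operator[OF assms(2)] *(2), of "- 1"] by simp
  then show ?thesis using *(1) by (auto simp: resolvent_triple_def)
qed

text \<open>Both pairings are the inner product of the graph elements \<open>(x, t)\<close> and
  \<open>(x', t')\<close>, whence the resolvent is symmetric and positive.\<close>

lemma resolvent_triple_cinner:
  assumes "resolvent_triple T u x t" "resolvent_triple T u' x' t'"
  shows "cinner x u' = cinner x x' + cinner t t'"
    and "cinner u x' = cinner x x' + cinner t t'"
proof -
  have "cinner t t' = cinner x (u' - x')" "cinner t' t = cinner x' (u - x)"
    using assms unfolding resolvent_triple_def by (blast dest: op_adjD)+
  then show "cinner x u' = cinner x x' + cinner t t'" "cinner u x' = cinner x x' + cinner t t'"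
    by (simp add: cinner.diff_right)
      (metis \<open>cinner t' t = cinner x' (u - x)\<close> add_diff_cancel_left' cinner.diff_left cinner_commute diff_add_cancel)
qed

text \<open>The three norms occur in one sum of squares that equals the square of
  \<open>norm u\<close>.\<close>

lemma resolvent_triple_norm:
  assumes "resolvent_triple T u x t"
  shows "norm x \<le> norm u" "norm t \<le> norm u" "norm (u - x) \<le> norm u"
proof -
  have "inner x u = (norm x)\<^sup>2 + (norm t)\<^sup>2"
    using arg_cong[OF resolvent_triple_cinner(1)[OF assms assms], of Re]
    by (simp add: inner_eq_Re_cinner cinner_self)
  moreover have "(norm (u - x))\<^sup>2 = (norm u)\<^sup>2 - 2 * inner x u + (norm x)\<^sup>2"
    by (simp add: power2_norm_eq_inner inner_simps inner_commute)
  ultimately have *: "(norm (u - x))\<^sup>2 + (norm x)\<^sup>2 + 2 * (norm t)\<^sup>2 = (norm u)\<^sup>2"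
    by simp
  then have "(norm x)\<^sup>2 \<le> (norm u)\<^sup>2" "(norm t)\<^sup>2 \<le> (norm u)\<^sup>2" "(norm (u - x))\<^sup>2 \<le> (norm u)\<^sup>2"
    by (smt (verit) zero_le_power2)+
  then show "norm x \<le> norm u" "norm t \<le> norm u" "norm (u - x) \<le> norm u"
    by simp_all
qed

lemma resolvent_triple_linear:
  fixes T :: "('a::complex_hilbert \<times> 'b::complex_hilbert) set"
  assumes "linear_operator T" "densely_defined T"
  shows "resolvent_triple T u x t \<Longrightarrow> resolvent_triple T u' x' t' \<Longrightarrow>
      resolvent_triple T (u + u') (x + x') (t + t')"
    and "resolvent_triple T u x t \<Longrightarrow> resolvent_triple T u' x' t' \<Longrightarrow>
      resolvent_triple T (u - u') (x - x') (t - t')"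
    and "resolvent_triple T u x t \<Longrightarrow> resolvent_triple T (c *\<^sub>C u) (c *\<^sub>C x) (c *\<^sub>C t)"
proof -
  have adj: "linear_operator (op_adj T)"
    using op_adj_closed_operator[OF assms(2)] closed_operator_linear by blast
  show "resolvent_triple T u x t \<Longrightarrow> resolvent_triple T u' x' t' \<Longrightarrow>
      resolvent_triple T (u + u') (x + x') (t + t')"
    using linear_operatorD(2)[OF assms(1), of x t x' t'] linear_operatorD(2)[OF adj, of t "u - x" t' "u' - x'"]
    by (simp add: resolvent_triple_def add_diff_add)
  show "resolvent_triple T u x t \<Longrightarrow> resolvent_triple T u' x' t' \<Longrightarrow>
      resolvent_triple T (u - u') (x - x') (t - t')"
    using linear_operatorD(4)[OF assms(1), of x t x' t'] linear_operatorD(4)[OF adj, of t "u - x" t' "u' - x'"]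
    by (simp add: resolvent_triple_def algebra_simps)
  show "resolvent_triple T u x t \<Longrightarrow> resolvent_triple T (c *\<^sub>C u) (c *\<^sub>C x) (c *\<^sub>C t)"
    using linear_operatorD(3)[OF assms(1), of x t c] linear_operatorD(3)[OF adj, of t "u - x" c]
    by (simp add: resolvent_triple_def scaleC_diff_right)
qed

lemma resolvent_triple_unique:
  fixes T :: "('a::complex_hilbert \<times> 'b::complex_hilbert) set"
  assumes "linear_operator T" "densely_defined T"
    and "resolvent_triple T u x t" "resolvent_triple T u x' t'"
  shows "x = x'" "t = t'"
proof -
  have "resolvent_triple T 0 (x - x') (t - t')"
    using resolvent_triple_linear(2)[OF assms] by simp
  then show "x = x'" "t = t'"
    using resolvent_triple_norm by fastforce+
qed

text \<open>The domain of \<open>T\<^sup>*T\<close> is a core of \<open>T\<close>.\<close>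

lemma resolvent_core:
  assumes T: "closed_operator T" "densely_defined T" and xy: "(x, y) \<in> T"
  obtains f g where "\<And>n. \<exists>u. resolvent_triple T u (f n) (g n)" "f \<longlonglongrightarrow> x" "g \<longlonglongrightarrow> y"
proof -
  let ?R = "{(x, t). \<exists>u. resolvent_triple T u x t}"
  have R: "csubspace ?R"
    unfolding complex_vector.subspace_def
  proof (intro conjI ballI allI)
    show "0 \<in> ?R"
      using resolvent_triple_linear(3)[OF closed_operator_linear[OF T(1)] T(2), of _ _ _ 0]
        resolvent_triple_exists[OF T, of 0] by (fastforce simp: zero_prod_def)
  next
    fix p q assume "p \<in> ?R" "q \<in> ?R"
    then obtain u v where "resolvent_triple T u (fst p) (snd p)" "resolvent_triple T v (fst q) (snd q)"
      by auto
    from resolvent_triple_linear(1)[OF closed_operator_linear[OF T(1)] T(2) this]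
    show "p + q \<in> ?R"
      by (auto simp: plus_prod_def)
  next
    fix c p assume "p \<in> ?R"
    then obtain u where "resolvent_triple T u (fst p) (snd p)"
      by auto
    from resolvent_triple_linear(3)[OF closed_operator_linear[OF T(1)] T(2) this]
    show "c *\<^sub>C p \<in> ?R"
      by (auto simp: scaleC_prod_def)
  qed
  obtain m where m: "m \<in> closure ?R" "\<And>p. p \<in> closure ?R \<Longrightarrow> inner ((x, y) - m) p = 0"
    using orthogonal_projection_exists[OF subspace_closure[OF subspace_if_csubspace[OF R]] closed_closure,
        of "(x, y)"] by auto
  obtain s where s: "\<And>n. s n \<in> ?R" "s \<longlonglongrightarrow> m"
    using m(1) unfolding closure_sequential by blast
  have "?R \<subseteq> T"
    by (auto simp: resolvent_triple_def)
  from subsetD[OF this s(1)] have "\<And>n. s n \<in> T" .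
  then have "m \<in> T"
    using T(1) s(2) closed_sequentially[of T s] by (simp add: closed_operator_def)
  then obtain a b where ab: "(x, y) - m = (a, b)" "(a, b) \<in> T"
    using closed_operatorD(4)[OF T(1) xy] by (cases m) auto
  \<comment> \<open>The residue \<open>(a, b)\<close> lies in \<open>T\<close> and is orthogonal to
    every \<open>(x', t)\<close>. Moving \<open>T\<close> from \<open>a\<close> to \<open>t\<close>
    as the adjoint turns this into orthogonality of \<open>a\<close> to
    \<open>x' + (u - x')\<close>, which is \<open>u\<close>.\<close>
  have "inner a u = 0" for u
  proof -
    obtain x' t where xt: "resolvent_triple T u x' t"
      using resolvent_triple_exists[OF T] by blast
    then have "(x', t) \<in> ?R"
      by auto
    then have "inner ((x, y) - m) (x', t) = 0"
      by (intro m(2) subsetD[OF closure_subset])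
    then have "inner a x' + inner b t = 0"
      by (simp add: ab(1))
    moreover have "cinner b t = cinner a (u - x')"
      using xt ab op_adjD unfolding resolvent_triple_def by blast
    ultimately show ?thesis
      by (simp add: inner_eq_Re_cinner cinner.diff_right)
  qed
  then have "a = 0" by (metis inner_eq_zero_iff)
  moreover then have "b = 0"
    using ab(2) closed_operatorD(1,5)[OF T(1)] by blast
  ultimately have "m = (x, y)"
    using ab(1) by (simp add: zero_prod_def[symmetric])
  then have "(\<lambda>n. fst (s n)) \<longlonglongrightarrow> x" "(\<lambda>n. snd (s n)) \<longlonglongrightarrow> y"
    using tendsto_fst[OF s(2)] tendsto_snd[OF s(2)] by auto
  then show thesis
    using that[of "\<lambda>n. fst (s n)" "\<lambda>n. snd (s n)"] s(1) by (simp add: case_prod_beta)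
qed

section \<open>Normal operators\<close>

lemma normalD:
  assumes "normal N"
  shows "closed_operator N" "densely_defined N" "op_adj N \<circ>\<^sub>o N = N \<circ>\<^sub>o op_adj N"
  using assms by (simp_all add: normal_in_def)

lemma normal_op_adj:
  assumes "normal N"
  shows "normal (op_adj N)"
  using normalD[OF assms] op_adj_op_adj[of N] op_adj_closed_operator[of N]
    op_adj_densely_defined[of N] by (simp add: normal_in_def)

text \<open>Normality lets \<open>N\<^sup>*N x = u - x\<close> be read as
  \<open>N N\<^sup>* x = u - x\<close>, so \<open>N\<close> and its adjoint share the component
  \<open>x\<close>.\<close>

lemma resolvent_triple_normal:
  assumes "normal N" "resolvent_triple N u x t"
  shows "\<exists>s. resolvent_triple (op_adj N) u x s"
proof -
  have "(x, u - x) \<in> op_adj N \<circ>\<^sub>o N"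
    using assms(2) by (auto simp: op_comp_def resolvent_triple_def)
  then have "(x, u - x) \<in> N \<circ>\<^sub>o op_adj N"
    by (simp add: normalD(3)[OF assms(1)])
  then show ?thesis
    by (auto simp: op_comp_def resolvent_triple_def op_adj_op_adj normalD(1)[OF assms(1)])
qed

text \<open>On the domain of \<open>N\<^sup>*N\<close> the squares of both norms equal the pairing
  of \<open>N\<^sup>*N x\<close> with \<open>x\<close>. Approximation along this core extends the
  equality, and with it membership in the domain of the adjoint.\<close>

lemma normal_adj_norm:
  assumes N: "normal N" and xy: "(x, y) \<in> N"
  obtains w where "(x, w) \<in> op_adj N" "norm w = norm y"
proof -
  note closed = normalD(1)[OF N] and dense = normalD(2)[OF N]
  note closed' = op_adj_closed_operator[OF dense]
  have eq: "norm s = norm b" if ab: "resolvent_triple N u a b" and as: "(a, s) \<in> op_adj N" for u a b s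
  proof -
    obtain s' where "resolvent_triple (op_adj N) u a s'"
      using resolvent_triple_normal[OF N ab] by blast
    moreover then have "s' = s"
      using as closed_operatorD(5)[OF closed'] by (auto simp: resolvent_triple_def)
    ultimately have "(s, u - a) \<in> N"
      by (simp add: resolvent_triple_def op_adj_op_adj closed)
    then have "cinner (u - a) a = cinner s s"
      by (rule op_adjD[OF as])
    moreover have "cinner b b = cinner a (u - a)"
      using ab by (auto simp: resolvent_triple_def dest: op_adjD)
    ultimately have "cinner s s = cnj (cinner b b)"
      using cinner_commute[of "u - a" a] by simp
    then have "complex_of_real ((norm s)\<^sup>2) = complex_of_real ((norm b)\<^sup>2)"
      by (simp add: cinner_self)
    then have "(norm s)\<^sup>2 = (norm b)\<^sup>2"
      using of_real_eq_iff by blast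
    then show ?thesis by simp
  qed
  obtain f g where fg: "\<And>n. \<exists>u. resolvent_triple N u (f n) (g n)" "f \<longlonglongrightarrow> x" "g \<longlonglongrightarrow> y"
    using resolvent_core[OF closed dense xy] by blast
  then obtain u where u: "\<And>n. resolvent_triple N (u n) (f n) (g n)"
    by metis
  then have "\<exists>s. (f n, s) \<in> op_adj N" for n
    using resolvent_triple_normal[OF N] by (fastforce simp: resolvent_triple_def)
  then obtain s where s: "\<And>n. (f n, s n) \<in> op_adj N"
    by metis
  \<comment> \<open>Equality of norms for differences makes \<open>s\<close> Cauchy because
    \<open>g\<close> converges.\<close>
  have "norm (s i - s j) = norm (g i - g j)" for i j
    using eq[OF resolvent_triple_linear(2)[OF closed_operator_linear[OF closed] dense u u]]
      closed_operatorD(4)[OF closed' s s] by blast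
  moreover have "Cauchy g"
    using LIMSEQ_imp_Cauchy[OF fg(3)] .
  ultimately have "Cauchy s"
    by (simp add: Cauchy_def dist_norm)
  then obtain w where w: "s \<longlonglongrightarrow> w"
    using Cauchy_convergent convergent_def by blast
  then have "(x, w) \<in> op_adj N"
    using closed_operator_tendsto[OF closed' s fg(2)] by blast
  moreover have "norm w = norm y"
  proof (rule LIMSEQ_unique)
    show "(\<lambda>n. norm (s n)) \<longlonglongrightarrow> norm w"
      by (intro tendsto_norm w)
    show "(\<lambda>n. norm (s n)) \<longlonglongrightarrow> norm y"
      using tendsto_norm[OF fg(3)] by (simp add: eq[OF u s])
  qed
  ultimately show thesis by (rule that)
qed

text \<open>This expresses normality of \<open>N - z\<close>. After expanding the squares, the cross
  terms agree because \<open>cinner y x = cinner x w\<close>.\<close>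

lemma normal_shift_norm:
  assumes N: "normal N" and xy: "(x, y) \<in> N" and xw: "(x, w) \<in> op_adj N"
  shows "norm (y - z *\<^sub>C x) = norm (w - cnj z *\<^sub>C x)"
proof -
  obtain w' where "(x, w') \<in> op_adj N" "norm w' = norm y"
    using normal_adj_norm[OF N xy] by blast
  then have "norm w = norm y"
    using closed_operatorD(5)[OF op_adj_closed_operator[OF normalD(2)[OF N]] xw] by blast
  have "cinner y x = cinner x w"
    using op_adjD[OF xw xy] .
  then have "inner y (z *\<^sub>C x) = inner w (cnj z *\<^sub>C x)"
    using cinner_commute[of x w] by (simp add: inner_eq_Re_cinner cinner_scaleC_right)
  moreover have "(norm (a - b))\<^sup>2 = (norm a)\<^sup>2 - 2 * inner a b + (norm b)\<^sup>2" for a b :: 'a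
    by (simp add: power2_norm_eq_inner inner_simps inner_commute)
  ultimately have "(norm (y - z *\<^sub>C x))\<^sup>2 = (norm (w - cnj z *\<^sub>C x))\<^sup>2"
    using \<open>norm w = norm y\<close> by (simp add: norm_scaleC)
  then show ?thesis by simp
qed

section \<open>Ranges of shifted operators\<close>

text \<open>Riesz representation on this graph divides \<open>l\<close> by \<open>T - z\<close>. It
  is a relation because \<open>T - z\<close> may have a kernel.\<close>

lemma csubspace_shift_graph:
  fixes T :: "('a::complex_vector \<times> 'a) set" and l :: "'a \<Rightarrow> complex"
  assumes T: "linear_operator T"
    and add: "\<And>x y. x \<in> Domain T \<Longrightarrow> y \<in> Domain T \<Longrightarrow> l (x + y) = l x + l y"
    and scale: "\<And>c x. x \<in> Domain T \<Longrightarrow> l (c *\<^sub>C x) = c * l x"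
  shows "csubspace {(y - z *\<^sub>C x, l x) | x y. (x, y) \<in> T}" (is "csubspace ?G")
  unfolding complex_vector.subspace_def
proof (intro conjI ballI allI)
  have "0 \<in> Domain T"
    using linear_operatorD(1)[OF T] by blast
  then have "l 0 = 0"
    using add[of 0 0] by simp
  then have "(0::'a \<times> complex) = (0 - z *\<^sub>C 0, l 0)"
    by (simp add: complex_vector.scale_zero_right zero_prod_def)
  then show "0 \<in> ?G"
    using linear_operatorD(1)[OF T] by blast
next
  fix p q assume "p \<in> ?G" "q \<in> ?G"
  then obtain x y x' y' where *: "(x, y) \<in> T" "p = (y - z *\<^sub>C x, l x)"
    "(x', y') \<in> T" "q = (y' - z *\<^sub>C x', l x')"
    by blast
  then have "l (x + x') = l x + l x'"
    by (intro add) blast+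
  then have "p + q = ((y + y') - z *\<^sub>C (x + x'), l (x + x'))"
    by (simp add: * scaleC_add_right)
  then show "p + q \<in> ?G"
    using linear_operatorD(2)[OF T *(1,3)] by blast
next
  fix c p assume "p \<in> ?G"
  then obtain x y where *: "(x, y) \<in> T" "p = (y - z *\<^sub>C x, l x)"
    by blast
  then have "l (c *\<^sub>C x) = c * l x"
    by (intro scale) blast
  then have "c *\<^sub>C p = (c *\<^sub>C y - z *\<^sub>C (c *\<^sub>C x), l (c *\<^sub>C x))"
    by (simp add: * scaleC_prod_def scaleC_complex_def scaleC_diff_right scaleC_scaleC mult.commute)
  then show "c *\<^sub>C p \<in> ?G"
    using linear_operatorD(3)[OF T *(1), of c] by blast
qed

lemma Domain_shift_graph: "Domain {(y - z *\<^sub>C x, l x) | x y. (x, y) \<in> T} = Range (op_shift T z)"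
  by (auto simp: op_shift_def)

lemma csubspace_Range_shift:
  assumes "linear_operator T"
  shows "csubspace (Range (op_shift T z))"
  using csubspace_Domain[OF csubspace_shift_graph[OF assms, of "\<lambda>_. 0" z]]
  by (simp add: Domain_shift_graph)

text \<open>Both closures are the orthogonal complement of the common kernel of \<open>N - z\<close> and its adjoint.\<close>

lemma normal_closure_range_shift:
  assumes N: "normal N"
  shows "closure (Range (op_shift (op_adj N) (cnj z))) \<subseteq> closure (Range (op_shift N z))"
proof
  fix v assume v: "v \<in> closure (Range (op_shift (op_adj N) (cnj z)))"
  let ?R = "Range (op_shift N z)"
  obtain a where a: "a \<in> closure ?R" "\<And>r. r \<in> closure ?R \<Longrightarrow> cinner (v - a) r = 0"
    using complex_orthogonal_projection_exists[OF csubspace_closure[OF csubspace_Range_shift] closed_closure]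
      closed_operator_linear normalD(1)[OF N] by metis
  define b where "b = v - a"
  have b0: "cinner (y - z *\<^sub>C x) b = 0" if "(x, y) \<in> N" for x y
  proof -
    have "y - z *\<^sub>C x \<in> closure ?R"
      using that closure_subset by (force simp: op_shift_def)
    then have "cinner b (y - z *\<^sub>C x) = 0"
      using a(2) by (simp add: b_def)
    then show ?thesis by (metis cinner_commute complex_cnj_zero)
  qed
  have badj: "(b, cnj z *\<^sub>C b) \<in> op_adj N"
    unfolding op_adj_iff using b0
    by (simp add: cinner.diff_left cinner_scaleC_left cinner_scaleC_right)
  have N': "op_adj (op_adj N) = N"
    using op_adj_op_adj normalD(1)[OF N] by blast
  obtain y where y: "(b, y) \<in> N"
    using normal_adj_norm[OF normal_op_adj[OF N] badj] unfolding N' by blast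
  \<comment> \<open>The adjoint of \<open>N - z\<close> annihilates \<open>b\<close>; equality of
    norms makes \<open>N - z\<close> annihilate it too.\<close>
  have "norm (y - z *\<^sub>C b) = 0"
    using normal_shift_norm[OF N y badj, of z] by simp
  then have bN: "(b, z *\<^sub>C b) \<in> N"
    using y by simp
  have adj_orth: "cinner r b = 0" if r: "r \<in> Range (op_shift (op_adj N) (cnj z))" for r
  proof -
    obtain x w where xw: "(x, w) \<in> op_adj N" "r = w - cnj z *\<^sub>C x"
      using r by (auto simp: op_shift_def)
    have "cinner w b = cnj (cinner (z *\<^sub>C b) x)"
      using op_adjD[OF xw(1) bN] cinner_commute[of w b] by simp
    also have "\<dots> = cnj z * cinner x b"
      using cinner_commute[of x b] by (simp add: cinner_scaleC_left)
    finally show ?thesis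
      by (simp add: xw(2) cinner.diff_left cinner_scaleC_left)
  qed
  obtain s where s: "\<And>n. s n \<in> Range (op_shift (op_adj N) (cnj z))" "s \<longlonglongrightarrow> v"
    using v unfolding closure_sequential by blast
  have "(\<lambda>n. cinner (s n) b) \<longlonglongrightarrow> cinner v b"
    by (intro cinner.tendsto s tendsto_const)
  then have "cinner v b = 0"
    by (simp add: adj_orth[OF s(1)] LIMSEQ_const_iff)
  moreover have "cinner b a = 0"
    using a by (simp add: b_def)
  then have "cinner a b = 0"
    by (metis cinner_commute complex_cnj_zero)
  ultimately have "cinner b b = 0"
    by (simp add: b_def cinner.diff_left)
  then have "v = a"
    by (simp add: cinner_self b_def)
  then show "v \<in> closure ?R" using a(1) by simp
qed

text \<open>Here \<open>J = (1 + N\<^sup>*N)\<^sup>-\<^sup>1\<close>, \<open>K = N J\<close> and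
  \<open>L = N K\<close>: bounded operators that commute with \<open>N\<close> and let it be applied
  twice on the range of \<open>J\<close>.\<close>

lemma normal_resolvent_operators:
  fixes N :: "('a::complex_hilbert \<times> 'a) set"
  assumes N: "normal N"
  obtains J K L where
    "bounded_clinear_map J" "bounded_clinear_map K" "bounded_clinear_map L"
    "intertwines J N N" "intertwines K N N" "intertwines L N N"
    "\<And>u. (J u, K u) \<in> N" "\<And>u. (K u, L u) \<in> N"
    "\<And>u. norm (J u) \<le> norm u" "\<And>u. norm (K u) \<le> norm u"
    "\<And>u v. cinner (J u) v = cinner u (J v)" "\<And>u. cinner u (J u) = 0 \<Longrightarrow> u = 0"
proof -
  note closed = normalD(1)[OF N] and dense = normalD(2)[OF N]
  note lin = closed_operator_linear[OF closed]
  obtain J K where JK: "\<And>u. resolvent_triple N u (J u) (K u)"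
    using resolvent_triple_exists[OF closed dense] by metis
  then have JKN: "(J u, K u) \<in> N" and K_adj: "(K u, u - J u) \<in> op_adj N" for u
    by (auto simp: resolvent_triple_def)
  \<comment> \<open>\<open>K u\<close> lies in the domain of the adjoint, hence in that of
    \<open>N\<close>, with equal norms of the images.\<close>
  have "\<exists>l. (K u, l) \<in> N \<and> norm l = norm (u - J u)" for u
    using normal_adj_norm[OF normal_op_adj[OF N] K_adj] unfolding op_adj_op_adj[OF closed] by metis
  then obtain L where L: "\<And>u. (K u, L u) \<in> N" "\<And>u. norm (L u) = norm (u - J u)"
    by metis
  note uniq = resolvent_triple_unique[OF lin dense]
  have add: "J (u + v) = J u + J v" "K (u + v) = K u + K v" for u v
    using uniq JK resolvent_triple_linear(1)[OF lin dense JK JK] by blast+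
  have scale: "J (c *\<^sub>C u) = c *\<^sub>C J u" "K (c *\<^sub>C u) = c *\<^sub>C K u" for c u
    using uniq JK resolvent_triple_linear(3)[OF lin dense JK] by blast+
  have "L (u + v) = L u + L v" for u v
    using L(1)[of "u + v"] linear_operatorD(2)[OF lin L(1) L(1), of u v] linear_operatorD(5)[OF lin]
    by (simp add: add)
  moreover have "L (c *\<^sub>C u) = c *\<^sub>C L u" for c u
    using L(1)[of "c *\<^sub>C u"] linear_operatorD(3)[OF lin L(1), of c u] linear_operatorD(5)[OF lin]
    by (simp add: scale)
  moreover have norms: "norm (J u) \<le> norm u" "norm (K u) \<le> norm u" "norm (L u) \<le> norm u" for u
    using resolvent_triple_norm[OF JK] by (simp_all add: L(2))
  ultimately have bounded: "bounded_clinear_map J" "bounded_clinear_map K" "bounded_clinear_map L"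
    unfolding bounded_clinear_map_def clinear_map_def using add scale
    by (simp_all add: exI[of _ 1])
  have commute: "(J x, J y) \<in> N" if xy: "(x, y) \<in> N" for x y
  proof -
    obtain s where s: "resolvent_triple (op_adj N) x (J x) s"
      using resolvent_triple_normal[OF N JK] by blast
    then have "(s, x - J x) \<in> N"
      by (simp add: resolvent_triple_def op_adj_op_adj closed)
    \<comment> \<open>The adjoint followed by \<open>N\<close> sends \<open>K x\<close> to
      \<open>y - K x\<close>. Reversing the order exhibits \<open>K x\<close> as the resolvent at
      \<open>y\<close>, that is \<open>N J x = J N x\<close>.\<close>
    have "(K x, y - K x) \<in> N \<circ>\<^sub>o op_adj N"
      using K_adj[of x] linear_operatorD(4)[OF lin xy JKN[of x]] by (auto simp: op_comp_def)
    then have "(K x, y - K x) \<in> op_adj N \<circ>\<^sub>o N"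
      by (simp add: normalD(3)[OF N])
    then obtain t where "resolvent_triple N y (K x) t"
      by (auto simp: op_comp_def resolvent_triple_def)
    then have "K x = J y"
      using uniq(1) JK by blast
    then show ?thesis using JKN[of x] by simp
  qed
  have KJ: "J y = K x" if "(x, y) \<in> N" for x y
    using commute[OF that] JKN[of x] linear_operatorD(5)[OF lin] by blast
  have K_commute: "(K x, K y) \<in> N" if "(x, y) \<in> N" for x y
    using JKN[of y] KJ[OF that] by simp
  have LK: "K y = L x" if "(x, y) \<in> N" for x y
    using K_commute[OF that] L(1)[of x] linear_operatorD(5)[OF lin] by blast
  have L_commute: "(L x, L y) \<in> N" if "(x, y) \<in> N" for x y
    using L(1)[of y] LK[OF that] by simp
  have pos: "u = 0" if "cinner u (J u) = 0" for u
  proof -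
    have "complex_of_real ((norm (J u))\<^sup>2 + (norm (K u))\<^sup>2) = 0"
      using resolvent_triple_cinner(2)[OF JK JK, of u u] that by (simp add: cinner_self)
    then have "(norm (J u))\<^sup>2 + (norm (K u))\<^sup>2 = 0"
      using of_real_eq_0_iff by blast
    then have "J u = 0" "K u = 0"
      by (simp_all add: sum_power2_eq_zero_iff)
    then have "(0, u) \<in> op_adj N"
      using K_adj[of u] by simp
    then show "u = 0"
      using closed_operatorD(1,5)[OF op_adj_closed_operator[OF dense]] by blast
  qed
  have "intertwines J N N" "intertwines K N N" "intertwines L N N"
    unfolding intertwines_def using commute K_commute L_commute by blast+
  moreover have "cinner (J u) v = cinner u (J v)" for u v
    using resolvent_triple_cinner[OF JK[of u] JK[of v]] by simp
  ultimately show thesis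
    using that[OF bounded _ _ _ JKN L(1) norms(1,2) _ pos] by blast
qed

section \<open>A Liouville argument for normal operators\<close>

text \<open>\<open>u = (N - z) (F z)\<close> for every \<open>z\<close>, with bounded
  \<open>F\<close>. For normal \<open>N\<close> the closure condition selects the solution
  orthogonal to the kernel of \<open>N - z\<close>; it also yields the continuity needed for
  differentiating.\<close>

definition in_all_ranges :: "('a::complex_hilbert \<times> 'a) set \<Rightarrow> 'a \<Rightarrow> bool" where
  "in_all_ranges N u \<longleftrightarrow> (\<exists>F c. \<forall>z. (F z, u + z *\<^sub>C F z) \<in> N \<and>
     F z \<in> closure (Range (op_shift N z)) \<and> norm (F z) \<le> c)"

lemma intertwines_closure_range_shift:
  assumes C: "bounded_clinear_map C" "intertwines C N N" and v: "v \<in> closure (Range (op_shift N z))"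
  shows "C v \<in> closure (Range (op_shift N z))"
proof -
  obtain s where s: "\<And>n. s n \<in> Range (op_shift N z)" "s \<longlonglongrightarrow> v"
    using v unfolding closure_sequential by blast
  have "C r \<in> Range (op_shift N z)" if r: "r \<in> Range (op_shift N z)" for r
  proof -
    obtain x y where "(x, y) \<in> N" "r = y - z *\<^sub>C x"
      using r by (auto simp: op_shift_def)
    then have "(C x, C y) \<in> N" "C r = C y - z *\<^sub>C C x"
      using intertwinesD[OF C(2)] by (simp_all add: bounded_clinear_mapD[OF C(1)])
    then show ?thesis by (auto simp: op_shift_def)
  qed
  then show ?thesis
    unfolding closure_sequential
    by (intro exI[of _ "\<lambda>n. C (s n)"]) (simp add: s bounded_clinear_map_tendsto[OF C(1)])
qed

text \<open>The quotients for \<open>C u\<close> are \<open>C (F z)\<close>.\<close>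

lemma in_all_ranges_intertwines:
  assumes C: "bounded_clinear_map C" "intertwines C N N" and u: "in_all_ranges N u"
  shows "in_all_ranges N (C u)"
proof -
  obtain F c where F: "\<And>z. (F z, u + z *\<^sub>C F z) \<in> N"
    "\<And>z. F z \<in> closure (Range (op_shift N z))" "\<And>z. norm (F z) \<le> c"
    using u unfolding in_all_ranges_def by blast
  obtain d where d: "d > 0" "\<And>x. norm (C x) \<le> d * norm x"
    using bounded_clinear_map_bound[OF C(1)] by blast
  have "norm (C (F z)) \<le> d * c" for z
    using order_trans[OF d(2) mult_left_mono[OF F(3)[of z]]] d(1) by simp
  moreover have "(C (F z), C u + z *\<^sub>C C (F z)) \<in> N" for z
    using intertwinesD[OF C(2) F(1)[of z]] by (simp add: bounded_clinear_mapD[OF C(1)])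
  ultimately show ?thesis
    unfolding in_all_ranges_def using intertwines_closure_range_shift[OF C F(2)]
    by (intro exI[of _ "\<lambda>z. C (F z)"] exI[of _ "d * c"]) blast
qed

text \<open>With \<open>F z = (N - z)\<^sup>-\<^sup>1 u\<close>, the function \<open>\<langle>u, f z\<rangle> = l (F z)\<close> has the difference quotients
  \<open>\<langle>F z, f w\<rangle>\<close>; it is therefore entire, and it is bounded.\<close>

lemma in_all_ranges_cinner_const:
  assumes l: "\<And>x y z. (x, y) \<in> N \<Longrightarrow> l x = cinner (y - z *\<^sub>C x) (f z)"
    and f: "\<And>z. norm (f z) \<le> c" and u: "in_all_ranges N u"
  shows "cinner u (f z) = cinner u (f w)"
proof -
  obtain F d where F: "\<And>z. (F z, u + z *\<^sub>C F z) \<in> N"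
    "\<And>z. F z \<in> closure (Range (op_shift N z))" "\<And>z. norm (F z) \<le> d"
    using u unfolding in_all_ranges_def by blast
  define \<phi> where "\<phi> z = cinner u (f z)" for z
  have "c \<ge> 0"
    using f[of 0] norm_ge_zero order_trans by blast
  have \<phi>_l: "\<phi> z = l (F z)" for z
    using l[OF F(1), of z z] by (simp add: \<phi>_def)
  have diff: "\<phi> z - \<phi> w = (z - w) * cinner (F z) (f w)" for z w
    using l[OF F(1), of z w]
    by (simp add: \<phi>_l[of z]) (simp add: \<phi>_def cinner.diff_left cinner.add_left cinner_scaleC_left algebra_simps)
  \<comment> \<open>For \<open>r = (N - w) x\<close> the increment is explicit and of order
    \<open>z - w\<close>. A general \<open>v\<close> is approximated by such \<open>r\<close>, with
    an error controlled by the uniform bound on \<open>f\<close>.\<close>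
  have cont: "((\<lambda>z. cinner v (f z)) \<longlongrightarrow> cinner v (f w)) (at w)"
    if v: "v \<in> closure (Range (op_shift N w))" for v w
  proof (rule metric_LIM_I)
    fix e :: real assume "e > 0"
    then have "e / (4 * (c + 1)) > 0" using \<open>c \<ge> 0\<close> by simp
    then obtain r where r: "r \<in> Range (op_shift N w)" "dist r v < e / (4 * (c + 1))"
      using v unfolding closure_approachable by blast
    then obtain x y where xy: "(x, y) \<in> N" "r = y - w *\<^sub>C x"
      by (auto simp: op_shift_def)
    have r_diff: "cinner r (f z) - cinner r (f w) = (z - w) * cinner x (f z)" for z
      using l[OF xy(1), of z] l[OF xy(1), of w]
      by (simp add: xy(2) cinner.diff_left cinner_scaleC_left algebra_simps)
    define s where "s = e / 2 / (norm x * c + 1)"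
    have pos: "norm x * c + 1 > 0"
      using \<open>c \<ge> 0\<close> by (smt (verit) mult_nonneg_nonneg norm_ge_zero)
    then have "s > 0" using \<open>e > 0\<close> by (simp add: s_def)
    moreover have "dist (cinner v (f z)) (cinner v (f w)) < e" if z: "z \<noteq> w" "dist z w < s" for z
    proof -
      have small: "cmod (cinner (v - r) (f t)) \<le> e / 4" for t
      proof -
        have "cmod (cinner (v - r) (f t)) \<le> norm (v - r) * norm (f t)"
          by (rule cinner_Cauchy_Schwarz)
        also have "\<dots> \<le> e / (4 * (c + 1)) * (c + 1)"
          using r(2) f[of t] \<open>c \<ge> 0\<close> \<open>e > 0\<close> by (intro mult_mono) (auto simp: dist_norm norm_minus_commute)
        also have "\<dots> = e / 4" using \<open>c \<ge> 0\<close> by (simp add: field_simps)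
        finally show ?thesis .
      qed
      have "cmod (cinner r (f z) - cinner r (f w)) = cmod (z - w) * cmod (cinner x (f z))"
        by (simp add: r_diff norm_mult)
      also have "\<dots> \<le> cmod (z - w) * (norm x * c)"
        by (intro mult_left_mono order_trans[OF cinner_Cauchy_Schwarz] f) simp_all
      also have "\<dots> \<le> cmod (z - w) * (norm x * c + 1)"
        by (intro mult_left_mono) simp_all
      also have "\<dots> < s * (norm x * c + 1)"
        using z(2) pos by (intro mult_strict_right_mono) (simp_all add: dist_norm)
      also have "\<dots> = e / 2"
        using pos unfolding s_def by (metis less_irrefl nonzero_eq_divide_eq)
      finally have "cmod (cinner r (f z) - cinner r (f w)) < e / 2" .
      moreover have "cinner v (f z) - cinner v (f w) =
          cinner (v - r) (f z) + (cinner r (f z) - cinner r (f w)) - cinner (v - r) (f w)"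
        by (simp add: cinner.diff_left)
      then have "cmod (cinner v (f z) - cinner v (f w)) \<le> cmod (cinner (v - r) (f z)) +
          cmod (cinner r (f z) - cinner r (f w)) + cmod (cinner (v - r) (f w))"
        by (metis (no_types, lifting) norm_triangle_ineq norm_triangle_ineq4 add_right_mono order_trans)
      ultimately show ?thesis
        using small[of z] small[of w] by (simp add: dist_norm)
    qed
    ultimately show "\<exists>s>0. \<forall>z. z \<noteq> w \<and> dist z w < s \<longrightarrow> dist (cinner v (f z)) (cinner v (f w)) < e"
      by blast
  qed
  have "(\<phi> has_field_derivative cinner (F w) (f w)) (at w)" for w
  proof -
    \<comment> \<open>The roles in \<open>diff\<close> are exchanged, so that \<open>F w\<close>
      stays fixed while \<open>f z\<close> varies.\<close>
    have "(\<phi> z - \<phi> w) / (z - w) = cinner (F w) (f z)" if "z \<noteq> w" for z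
      using diff[of w z] that by (simp add: field_simps)
    then have "((\<lambda>z. (\<phi> z - \<phi> w) / (z - w)) \<longlongrightarrow> cinner (F w) (f w)) (at w)"
      using cont[OF F(2)] by (subst LIM_cong[OF refl _ refl]) auto
    then show ?thesis by (simp add: has_field_derivative_iff)
  qed
  then have "\<phi> holomorphic_on UNIV"
    by (auto simp: holomorphic_on_def field_differentiable_def intro: DERIV_subset)
  moreover have "bounded (range \<phi>)"
  proof (rule boundedI)
    fix y assume "y \<in> range \<phi>"
    then show "norm y \<le> norm u * c"
      using order_trans[OF cinner_Cauchy_Schwarz mult_left_mono[OF f]] by (auto simp: \<phi>_def)
  qed
  ultimately have "\<phi> constant_on UNIV"
    by (rule Liouville_theorem)
  then show ?thesis by (auto simp: constant_on_def \<phi>_def)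
qed

text \<open>\<open>l\<close> is represented by some \<open>f z\<close> through \<open>N - z\<close>
  for each \<open>z\<close>, and \<open>l\<close> composed with \<open>J\<close> by a vector
  \<open>y0\<close>. The Liouville argument applies to \<open>J y0\<close>, \<open>K y0\<close> and
  \<open>L y0\<close> and gives \<open>l (J y0) = 0\<close>, which is the square of the norm of
  \<open>y0\<close>; then \<open>f 0\<close> vanishes as well.\<close>

lemma normal_bounded_functional_eq_0:
  fixes N :: "('a::complex_hilbert \<times> 'a) set"
  assumes N: "normal N"
    and add: "\<And>x y. x \<in> Domain N \<Longrightarrow> y \<in> Domain N \<Longrightarrow> l (x + y) = l x + l y"
    and scale: "\<And>k x. x \<in> Domain N \<Longrightarrow> l (k *\<^sub>C x) = k * l x"
    and bound: "\<And>x y z. (x, y) \<in> N \<Longrightarrow> cmod (l x) \<le> c * norm (y - z *\<^sub>C x)"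
    and "c \<ge> 0" and x: "x \<in> Domain N"
  shows "l x = 0"
proof -
  note lin = closed_operator_linear[OF normalD(1)[OF N]]
  have l_range: "\<exists>f \<in> closure (Range (op_shift N z)). norm f \<le> c \<and>
      (\<forall>x y. (x, y) \<in> N \<longrightarrow> l x = cinner (y - z *\<^sub>C x) f)" for z
  proof -
    let ?G = "{(y - z *\<^sub>C x, l x) | x y. (x, y) \<in> N}"
    have "csubspace ?G"
      using add scale by (rule csubspace_shift_graph[OF lin])
    moreover have "cmod s \<le> c * norm r" if "(r, s) \<in> ?G" for r s
      using that bound by blast
    ultimately obtain f where f: "f \<in> closure (Domain ?G)" "norm f \<le> c" "\<forall>(r, s) \<in> ?G. s = cinner r f"
      using riesz_representation[of ?G c] \<open>c \<ge> 0\<close> by blast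
    show ?thesis
      using f(2,3) f(1)[unfolded Domain_shift_graph] by (intro bexI[of _ f]) auto
  qed
  then obtain f where f: "\<And>z. f z \<in> closure (Range (op_shift N z))" "\<And>z. norm (f z) \<le> c"
    "\<And>x y z. (x, y) \<in> N \<Longrightarrow> l x = cinner (y - z *\<^sub>C x) (f z)"
    by metis
  have const: "cinner u (f z) = cinner u (f w)" if "in_all_ranges N u" for u z w
    by (rule in_all_ranges_cinner_const[OF _ f(2) that]) (rule f(3))
  obtain J K L where bdd: "bounded_clinear_map J" "bounded_clinear_map K" "bounded_clinear_map L"
    and comm: "intertwines J N N" "intertwines K N N" "intertwines L N N"
    and JK: "\<And>u. (J u, K u) \<in> N" and KL: "\<And>u. (K u, L u) \<in> N"
    and J_le: "\<And>u. norm (J u) \<le> norm u" and K_le: "\<And>u. norm (K u) \<le> norm u"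
    and J_sym: "\<And>u v. cinner (J u) v = cinner u (J v)"
    and J_pos: "\<And>u. cinner u (J u) = 0 \<Longrightarrow> u = 0"
    using normal_resolvent_operators[OF N] by metis
  have dom: "(x, y) \<in> N \<Longrightarrow> x \<in> Domain N" for x y by blast
  \<comment> \<open>The bound at \<open>z = 0\<close> involves \<open>N J = K\<close>, a
    contraction, so \<open>l\<close> composed with \<open>J\<close> is bounded everywhere.\<close>
  obtain y0 where y0: "\<And>g. l (J g) = cinner g y0"
  proof -
    let ?G = "{(g, l (J g)) | g. True}"
    have l0: "l 0 = 0"
      using scale[of 0 0] linear_operatorD(1)[OF lin] by (auto simp: Domain_iff)
    have "csubspace ?G"
      unfolding complex_vector.subspace_def
      using add[OF dom dom, OF JK JK] scale[OF dom, OF JK]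
      by (auto simp: scaleC_prod_def zero_prod_def bounded_clinear_mapD[OF bdd(1)] l0 scaleC_complex_def)
    moreover have "cmod s \<le> c * norm r" if "(r, s) \<in> ?G" for r s
    proof -
      have "cmod s \<le> c * norm (K r - 0 *\<^sub>C J r)"
        using that bound[OF JK, of r 0] by blast
      also have "\<dots> \<le> c * norm r"
        using K_le[of r] \<open>c \<ge> 0\<close> by (simp add: mult_left_mono complex_vector.scale_zero_left)
      finally show ?thesis .
    qed
    ultimately obtain y0 where "\<forall>(r, s) \<in> ?G. s = cinner r y0"
      using riesz_representation[of ?G c] \<open>c \<ge> 0\<close> by blast
    then show thesis using that[of y0] by auto
  qed
  \<comment> \<open>\<open>(N - z) F = y0\<close> is solved by duality:
    \<open>cinner x y0 = l (J x)\<close> is bounded by \<open>(N - z) (J x)\<close>, hence by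
    \<open>(N - z) x\<close>, whose norm is that of the shifted adjoint at \<open>x\<close>. The
    representing \<open>F\<close> lies in the domain of the second adjoint, which is
    \<open>N\<close>.\<close>
  have y0_good: "in_all_ranges N y0"
  proof -
    have "\<exists>F. (F, y0 + z *\<^sub>C F) \<in> N \<and> F \<in> closure (Range (op_shift N z)) \<and> norm F \<le> c" for z
    proof -
      let ?G = "{(w - cnj z *\<^sub>C x, cinner x y0) | x w. (x, w) \<in> op_adj N}"
      note lin' = closed_operator_linear[OF op_adj_closed_operator[OF normalD(2)[OF N]]]
      have "csubspace ?G"
        by (rule csubspace_shift_graph[OF lin']) (simp_all add: cinner.add_left cinner_scaleC_left)
      moreover have "cmod s \<le> c * norm r" if rs: "(r, s) \<in> ?G" for r s
      proof -
        obtain x w where xw: "(x, w) \<in> op_adj N" "r = w - cnj z *\<^sub>C x" "s = cinner x y0"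
          using rs by blast
        obtain y where y: "(x, y) \<in> N"
          using normal_adj_norm[OF normal_op_adj[OF N] xw(1)]
          unfolding op_adj_op_adj[OF normalD(1)[OF N]] by metis
        have JN: "(J x, J y) \<in> N"
          using intertwinesD[OF comm(1) y] .
        have "cmod s \<le> c * norm (J y - z *\<^sub>C J x)"
          using bound[OF JN] by (simp add: xw(3) y0[symmetric])
        also have "\<dots> = c * norm (J (y - z *\<^sub>C x))"
          by (simp add: bounded_clinear_mapD[OF bdd(1)])
        also have "\<dots> \<le> c * norm (y - z *\<^sub>C x)"
          using \<open>c \<ge> 0\<close> by (intro mult_left_mono J_le)
        also have "\<dots> = c * norm r"
          by (simp add: xw(2) normal_shift_norm[OF N y xw(1)])
        finally show ?thesis .
      qed
      ultimately obtain F where F: "F \<in> closure (Domain ?G)" "norm F \<le> c"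
          "\<forall>(r, s) \<in> ?G. s = cinner r F"
        using riesz_representation[of ?G c] \<open>c \<ge> 0\<close> by blast
      have "F \<in> closure (Range (op_shift N z))"
        using F(1)[unfolded Domain_shift_graph] normal_closure_range_shift[OF N, of z] by blast
      moreover have "cinner w F = cinner x (y0 + z *\<^sub>C F)" if "(x, w) \<in> op_adj N" for x w
        using F(3) that by (fastforce simp: cinner.diff_left cinner_add_right cinner_scaleC_left cinner_scaleC_right)
      then have "(F, y0 + z *\<^sub>C F) \<in> op_adj (op_adj N)"
        by (simp add: op_adj_iff[of F])
      ultimately show ?thesis
        using F(2) by (auto simp: op_adj_op_adj normalD(1)[OF N])
    qed
    then show ?thesis
      unfolding in_all_ranges_def by metis
  qed
  \<comment> \<open>Since the pairings do not depend on \<open>z\<close>, the identity for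
    \<open>l v\<close> is a polynomial of degree one in \<open>z\<close> with constant value; its
    linear coefficient vanishes.\<close>
  have orth: "cinner v (f 0) = 0 \<and> cinner v' (f 0) = l v"
    if "(v, v') \<in> N" "in_all_ranges N v" "in_all_ranges N v'" for v v'
  proof -
    have "l v = cinner v' (f z) - z * cinner v (f z)" for z
      using f(3)[OF that(1)] by (simp add: cinner.diff_left cinner_scaleC_left)
    then have "l v = cinner v' (f 0) - z * cinner v (f 0)" for z
      using const[OF that(2), of z 0] const[OF that(3), of z 0] by metis
    from this[of 0] this[of 1] show ?thesis by simp
  qed
  \<comment> \<open>\<open>K y0\<close> is the image of \<open>J y0\<close> in the first equation
    and the preimage of \<open>L y0\<close> in the second.\<close>
  have "cinner (K y0) (f 0) = l (J y0)" "cinner (K y0) (f 0) = 0"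
    using orth[OF JK] orth[OF KL] in_all_ranges_intertwines[OF _ _ y0_good] bdd comm by blast+
  then have "y0 = 0"
    by (simp add: y0 cinner_self)
  then have lJ: "l (J g) = 0" for g
    by (simp add: y0 cinner.zero_right)
  have J_comm: "J y = K x" if "(x, y) \<in> N" for x y
    using intertwinesD[OF comm(1) that] JK[of x] linear_operatorD(5)[OF lin] by blast
  \<comment> \<open>Moving \<open>J\<close> across and commuting it with \<open>N\<close> turns the
    pairing into \<open>l (J x)\<close>. As \<open>f 0\<close> lies in the closure of this range,
    positivity of \<open>J\<close> will give \<open>f 0 = 0\<close>.\<close>
  have range_orth: "cinner r (J (f 0)) = 0" if r: "r \<in> Range (op_shift N 0)" for r
  proof -
    obtain x where "(x, r) \<in> N"
      using r by (auto simp: op_shift_def complex_vector.scale_zero_left)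
    then have "cinner r (J (f 0)) = cinner (K x) (f 0)"
      using J_sym[of r "f 0"] J_comm by simp
    also have "\<dots> = l (J x)"
      using f(3)[OF JK, of x 0] by (simp add: complex_vector.scale_zero_left)
    finally show ?thesis by (simp add: lJ)
  qed
  obtain s where s: "\<And>n. s n \<in> Range (op_shift N 0)" "s \<longlonglongrightarrow> f 0"
    using f(1)[of 0] unfolding closure_sequential by blast
  have "(\<lambda>n. cinner (s n) (J (f 0))) \<longlonglongrightarrow> cinner (f 0) (J (f 0))"
    by (intro cinner.tendsto s tendsto_const)
  then have "cinner (f 0) (J (f 0)) = 0"
    by (simp add: range_orth[OF s(1)] LIMSEQ_const_iff)
  then have "f 0 = 0" by (rule J_pos)
  then show ?thesis
    using x f(3)[of _ _ 0] by (auto simp: cinner.zero_right)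
qed

section \<open>Putnam--Fuglede for a normal and an \<open>M\<close>-hyponormal operator\<close>

lemma op_adj_shift:
  assumes "(x, w) \<in> op_adj T"
  shows "(x, w - cnj z *\<^sub>C x) \<in> op_adj (op_shift T z)"
  unfolding op_adj_iff
proof (intro allI impI)
  fix u v assume "(u, v) \<in> op_shift T z"
  then obtain y where y: "(u, y) \<in> T" "v = y - z *\<^sub>C u"
    by (auto simp: op_shift_def)
  show "cinner v x = cinner u (w - cnj z *\<^sub>C x)"
    using op_adjD[OF assms y(1)]
    by (simp add: y(2) cinner.diff_left cinner.diff_right cinner_scaleC_left cinner_scaleC_right)
qed

text \<open>\<open>N\<close> and its adjoint have the same domain, so the claim is the vanishing of
  the defect \<open>d\<close> on it.\<close>

theorem normal_M_hyponormal_intertwines_adjoint: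
  fixes N :: "('a::complex_hilbert \<times> 'a) set" and T :: "('b::complex_hilbert \<times> 'b) set"
  assumes N: "normal N" and T: "M_hyponormal T"
    and X: "bounded_clinear_map X" and XNT: "intertwines X N T"
  shows "intertwines X (op_adj N) (op_adj T)"
proof -
  obtain M where M: "M > 0" "\<And>z x u v. (x, u) \<in> op_adj (op_shift T z) \<Longrightarrow> (x, v) \<in> op_shift T z
      \<Longrightarrow> norm u \<le> M * norm v"
    using T unfolding M_hyponormal_def by blast
  obtain c where c: "c > 0" "\<And>x. norm (X x) \<le> c * norm x"
    using bounded_clinear_map_bound[OF X] by blast
  have "densely_defined T"
    using T by (simp add: M_hyponormal_def)
  note linN' = closed_operator_linear[OF op_adj_closed_operator[OF normalD(2)[OF N]]]
    and linT' = closed_operator_linear[OF op_adj_closed_operator[OF \<open>densely_defined T\<close>]]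
  have "\<exists>w. (x, w) \<in> op_adj N" if x: "x \<in> Domain N" for x
    using normal_adj_norm[OF N] x by blast
  then obtain n' where n': "\<And>x. x \<in> Domain N \<Longrightarrow> (x, n' x) \<in> op_adj N"
    by metis
  have "\<exists>s. (X x, s) \<in> op_adj T" if x: "x \<in> Domain N" for x
    using T intertwinesD[OF XNT] x unfolding M_hyponormal_def by blast
  then obtain t where t: "\<And>x. x \<in> Domain N \<Longrightarrow> (X x, t x) \<in> op_adj T"
    by metis
  define d where "d x = t x - X (n' x)" for x
  have linN: "linear_operator N"
    using closed_operator_linear normalD(1)[OF N] by blast
  have domN: "csubspace (Domain N)"
    using linN by (simp add: csubspace_Domain linear_operator_def)
  have d_add: "d (x + y) = d x + d y" if xy: "x \<in> Domain N" "y \<in> Domain N" for x y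
  proof -
    have xy_dom: "x + y \<in> Domain N"
      using complex_vector.subspace_add[OF domN xy] .
    have "n' (x + y) = n' x + n' y"
      using linear_operatorD(5)[OF linN' n'[OF xy_dom]] linear_operatorD(2)[OF linN'] n' xy by blast
    moreover have "t (x + y) = t x + t y"
      using linear_operatorD(5)[OF linT' t[OF xy_dom]] linear_operatorD(2)[OF linT' t t, OF xy]
      by (simp add: bounded_clinear_mapD[OF X])
    ultimately show ?thesis
      by (simp add: d_def bounded_clinear_mapD[OF X])
  qed
  have d_scale: "d (k *\<^sub>C x) = k *\<^sub>C d x" if x: "x \<in> Domain N" for k x
  proof -
    have x_dom: "k *\<^sub>C x \<in> Domain N"
      using complex_vector.subspace_scale[OF domN x] .
    have "n' (k *\<^sub>C x) = k *\<^sub>C n' x"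
      using linear_operatorD(5)[OF linN' n'[OF x_dom]] linear_operatorD(3)[OF linN' n'[OF x]] by blast
    moreover have "t (k *\<^sub>C x) = k *\<^sub>C t x"
      using linear_operatorD(5)[OF linT' t[OF x_dom]] linear_operatorD(3)[OF linT' t[OF x], of k]
      by (simp add: bounded_clinear_mapD[OF X])
    ultimately show ?thesis
      by (simp add: d_def bounded_clinear_mapD[OF X] scaleC_diff_right)
  qed
  have d_bound: "norm (d x) \<le> (M * c + c) * norm (y - z *\<^sub>C x)" if xy: "(x, y) \<in> N" for x y z
  proof -
    have x: "x \<in> Domain N" using xy by blast
    have "(X x, X (y - z *\<^sub>C x)) \<in> op_shift T z"
      using intertwinesD[OF XNT xy] by (auto simp: op_shift_def bounded_clinear_mapD[OF X])
    then have "norm (t x - cnj z *\<^sub>C X x) \<le> M * norm (X (y - z *\<^sub>C x))"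
      using M(2)[OF op_adj_shift[OF t[OF x]]] by blast
    also have "\<dots> \<le> M * (c * norm (y - z *\<^sub>C x))"
      using M(1) c(2) by (intro mult_left_mono) simp_all
    finally have 1: "norm (t x - cnj z *\<^sub>C X x) \<le> M * (c * norm (y - z *\<^sub>C x))" .
    have "norm (X (n' x - cnj z *\<^sub>C x)) \<le> c * norm (n' x - cnj z *\<^sub>C x)"
      by (rule c(2))
    also have "\<dots> = c * norm (y - z *\<^sub>C x)"
      by (simp add: normal_shift_norm[OF N xy n'[OF x]])
    finally have 2: "norm (X (n' x - cnj z *\<^sub>C x)) \<le> c * norm (y - z *\<^sub>C x)" .
    have "d x = (t x - cnj z *\<^sub>C X x) - X (n' x - cnj z *\<^sub>C x)"
      by (simp add: d_def bounded_clinear_mapD[OF X])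
    then have "norm (d x) \<le> norm (t x - cnj z *\<^sub>C X x) + norm (X (n' x - cnj z *\<^sub>C x))"
      by (simp only: norm_triangle_ineq4)
    with 1 2 show ?thesis by (simp add: algebra_simps)
  qed
  have d0: "d x = 0" if x: "x \<in> Domain N" for x
  proof -
    have "cinner (d x) (d x) = 0"
    \<comment> \<open>Pairing with the fixed vector \<open>d x\<close> makes the defect a scalar
      functional; evaluated at \<open>x\<close> it is the square of the norm of
      \<open>d x\<close>.\<close>
    proof (rule normal_bounded_functional_eq_0[OF N, where l = "\<lambda>y. cinner (d y) (d x)"])
      show "cmod (cinner (d u) (d x)) \<le> ((M * c + c) * norm (d x)) * norm (v - z *\<^sub>C u)"
        if "(u, v) \<in> N" for u v z
        using order_trans[OF cinner_Cauchy_Schwarz mult_right_mono[OF d_bound[OF that]]]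
        by (simp add: mult_ac)
    qed (use M(1) c(1) x in \<open>simp_all add: d_add d_scale cinner.add_left cinner_scaleC_left\<close>)
    then show ?thesis by (simp add: cinner_self)
  qed
  show ?thesis
    unfolding intertwines_def
  proof (intro allI impI)
    fix x w assume xw: "(x, w) \<in> op_adj N"
    have x: "x \<in> Domain N"
      using normal_adj_norm[OF normal_op_adj[OF N] xw]
      unfolding op_adj_op_adj[OF normalD(1)[OF N]] by blast
    have "n' x = w"
      using linear_operatorD(5)[OF linN' n'[OF x] xw] .
    then show "(X x, X w) \<in> op_adj T"
      using d0[OF x] t[OF x] by (simp add: d_def)
  qed
qed

section \<open>Reducing subspaces\<close>

definition is_projection :: "('a::complex_inner \<Rightarrow> 'a) \<Rightarrow> 'a set \<Rightarrow> bool" where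
  "is_projection P M \<longleftrightarrow> csubspace M \<and> closed M \<and> (\<forall>x. P x \<in> M \<and> x - P x \<in> ortho_compl M)"

lemma is_projectionD:
  assumes "is_projection P M"
  shows "csubspace M" "closed M" "P x \<in> M" "x - P x \<in> ortho_compl M"
  using assms by (simp_all add: is_projection_def)

lemma ortho_complD: "x \<in> ortho_compl M \<Longrightarrow> y \<in> M \<Longrightarrow> cinner x y = 0"
  by (simp add: ortho_compl_def)

lemma is_projection_on:
  assumes P: "is_projection P M" and x: "x \<in> M"
  shows "P x = x"
proof -
  have "x - P x \<in> M"
    using is_projectionD(1,3)[OF P] x complex_vector.subspace_diff by blast
  then have "cinner (x - P x) (x - P x) = 0"
    using ortho_complD[OF is_projectionD(4)[OF P]] by blast
  then show ?thesis by (simp add: cinner_self)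
qed

lemma is_projection_on_ortho_compl:
  assumes P: "is_projection P M" and x: "x \<in> ortho_compl M"
  shows "P x = 0"
proof -
  have "cinner x (P x) = 0" "cinner (x - P x) (P x) = 0"
    using ortho_complD[OF x] ortho_complD[OF is_projectionD(4)[OF P]] is_projectionD(3)[OF P] by blast+
  then have "cinner (P x) (P x) = 0"
    by (simp add: cinner.diff_left)
  then show ?thesis by (simp add: cinner_self)
qed

lemma is_projection_cinner:
  assumes P: "is_projection P M" and y: "y \<in> M"
  shows "cinner (P x) y = cinner x y"
  using ortho_complD[OF is_projectionD(4)[OF P] y, of x] by (simp add: cinner.diff_left)

text \<open>Pythagoras. It lets approximants from the domain of an operator be projected into
  \<open>M\<close>.\<close>

lemma is_projection_norm_diff:
  assumes P: "is_projection P M" and x: "x \<in> M"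
  shows "norm (P a - x) \<le> norm (a - x)"
proof -
  have "P a - x \<in> M"
    using is_projectionD(1,3)[OF P] x complex_vector.subspace_diff by blast
  then have "cinner (a - P a) (P a - x) = 0"
    using ortho_complD[OF is_projectionD(4)[OF P]] by blast
  then have "inner (a - P a) (P a - x) = 0"
    by (simp add: inner_eq_Re_cinner)
  then have "(norm ((a - P a) + (P a - x)))\<^sup>2 = (norm (a - P a))\<^sup>2 + (norm (P a - x))\<^sup>2"
    using norm_add_Pythagorean by (simp only: orthogonal_def)
  then have "(norm (P a - x))\<^sup>2 \<le> (norm (a - x))\<^sup>2"
    by simp
  then show ?thesis by simp
qed

text \<open>\<open>P\<close> fixes \<open>M\<close> and annihilates its complement;
  single-valuedness of \<open>T\<close> transfers this to the images.\<close>

lemma reduces_if_projection_intertwines: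
  assumes P: "is_projection P M" and T: "closed_operator T" and PT: "intertwines P T T"
  shows "reduces M T"
  unfolding reduces_def invariant_under_def
proof (intro conjI allI impI)
  fix x y assume xy: "(x, y) \<in> T" and "x \<in> M"
  then have "(x, P y) \<in> T"
    using intertwinesD[OF PT xy] is_projection_on[OF P] by simp
  then have "P y = y"
    by (rule closed_operatorD(5)[OF T _ xy])
  then show "y \<in> M"
    using is_projectionD(3)[OF P] by metis
next
  fix x y assume xy: "(x, y) \<in> T" and "x \<in> ortho_compl M"
  then have "(0, P y) \<in> T"
    using intertwinesD[OF PT xy] is_projection_on_ortho_compl[OF P] by simp
  then have "P y = 0"
    using closed_operatorD(1,5)[OF T] by blast
  then show "y \<in> ortho_compl M"
    using is_projectionD(4)[OF P, of y] by simp
qed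

text \<open>Projecting a test pair of \<open>T\<close> into \<open>M\<close> does not change its
  pairings with vectors of \<open>M\<close>.\<close>

lemma adjoint_in_op_restrict:
  assumes P: "is_projection P M" and PT: "intertwines P T T"
  shows "adjoint_in M M (op_restrict T M) = op_restrict (op_adj T) M"
proof -
  have "(y, w) \<in> op_adj T"
    if yw: "y \<in> M" "w \<in> M" "\<And>x v. (x, v) \<in> op_restrict T M \<Longrightarrow> cinner v y = cinner x w" for y w
    unfolding op_adj_iff
  proof (intro allI impI)
    fix x v assume xv: "(x, v) \<in> T"
    have "(P x, P v) \<in> op_restrict T M"
      using intertwinesD[OF PT xv] is_projectionD(3)[OF P] by (simp add: op_restrict_def)
    then show "cinner v y = cinner x w"
      using yw by (metis is_projection_cinner[OF P])
  qed
  then have "(y, w) \<in> op_restrict (op_adj T) M" if "(y, w) \<in> adjoint_in M M (op_restrict T M)" for y w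
    using that unfolding adjoint_in_def[of M] op_restrict_def[of "op_adj T"] by blast
  then have "adjoint_in M M (op_restrict T M) \<subseteq> op_restrict (op_adj T) M"
    by (rule subrelI)
  then show ?thesis
    by (auto simp: adjoint_in_def op_restrict_def)
qed

text \<open>Normality localized at \<open>u\<close>: \<open>(1 + T\<^sup>*T)\<^sup>-\<^sup>1\<close>
  and \<open>(1 + T T\<^sup>* )\<^sup>-\<^sup>1\<close> agree there.\<close>

definition balanced :: "('a::complex_hilbert \<times> 'a) set \<Rightarrow> 'a \<Rightarrow> bool" where
  "balanced T u \<longleftrightarrow> (\<exists>x t s. resolvent_triple T u x t \<and> resolvent_triple (op_adj T) u x s)"

lemma normal_balanced:
  assumes "normal N"
  shows "balanced N u"
  using resolvent_triple_exists[OF normalD(1,2)[OF assms]] resolvent_triple_normal[OF assms]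
  unfolding balanced_def by blast

lemma balanced_op_adj:
  assumes "closed_operator T" "balanced T u"
  shows "balanced (op_adj T) u"
  using assms unfolding balanced_def by (auto simp: op_adj_op_adj)

text \<open>A map intertwining both the operators and their adjoints carries resolvent triples to
  resolvent triples.\<close>

lemma balanced_intertwines:
  assumes A: "bounded_clinear_map A" and AT: "intertwines A T R" "intertwines A (op_adj T) (op_adj R)"
    and TR: "closed_operator T" "closed_operator R" and u: "balanced T u"
  shows "balanced R (A u)"
proof -
  obtain x t s where "resolvent_triple T u x t" "resolvent_triple (op_adj T) u x s"
    using u unfolding balanced_def by blast
  then have "resolvent_triple R (A u) (A x) (A t)" "resolvent_triple (op_adj R) (A u) (A x) (A s)"
    using AT TR by (auto simp: resolvent_triple_def op_adj_op_adj bounded_clinear_mapD(4)[OF A, symmetric]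
        dest: intertwinesD)
  then show ?thesis unfolding balanced_def by blast
qed

text \<open>Both resolvents are contractions, so the vectors at which they agree form a closed
  set.\<close>

lemma balanced_closure:
  assumes T: "closed_operator T" "densely_defined T"
    and S: "\<And>u. u \<in> S \<Longrightarrow> balanced T u" and u: "u \<in> closure S"
  shows "balanced T u"
proof -
  note T' = op_adj_closed_operator[OF T(2)] op_adj_densely_defined[OF T]
  obtain x t where x: "resolvent_triple T u x t"
    using resolvent_triple_exists[OF T] by blast
  obtain x' s where x': "resolvent_triple (op_adj T) u x' s"
    using resolvent_triple_exists[OF T'] by blast
  have "norm (x - x') \<le> e" if "e > 0" for e
  proof -
    obtain v where v: "v \<in> S" "dist v u < e / 2"
      using u \<open>e > 0\<close> unfolding closure_approachable by (metis half_gt_zero)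
    obtain y q r where y: "resolvent_triple T v y q" "resolvent_triple (op_adj T) v y r"
      using S[OF v(1)] unfolding balanced_def by blast
    have "norm (y - x) \<le> norm (v - u)" "norm (y - x') \<le> norm (v - u)"
      using resolvent_triple_norm(1) resolvent_triple_linear(2)[OF closed_operator_linear[OF T(1)] T(2) y(1) x]
        resolvent_triple_linear(2)[OF closed_operator_linear[OF T'(1)] T'(2) y(2) x'] by blast+
    moreover have "norm (x - x') \<le> norm (y - x') + norm (y - x)"
      using norm_triangle_ineq4[of "y - x'" "y - x"] by simp
    ultimately show ?thesis
      using v(2) by (simp add: dist_norm)
  qed
  then have "x = x'"
    by (metis dense_ge norm_le_zero_iff eq_iff_diff_eq_0)
  then show ?thesis
    using x x' unfolding balanced_def by blast
qed

lemma normal_in_op_restrict: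
  assumes P: "is_projection P M" and T: "closed_operator T" "densely_defined T"
    and PT: "intertwines P T T" "intertwines P (op_adj T) (op_adj T)"
    and balanced: "\<And>u. u \<in> M \<Longrightarrow> balanced T u"
  shows "normal_in M (op_restrict T M)"
proof -
  let ?T = "op_restrict T M" and ?T' = "op_restrict (op_adj T) M"
  note lin = closed_operator_linear[OF T(1)]
  note T' = op_adj_closed_operator[OF T(2)] op_adj_densely_defined[OF T]
  note lin' = closed_operator_linear[OF T'(1)]
  note M = is_projectionD[OF P]
  have inter: "?T = T \<inter> M \<times> M"
    by (auto simp: op_restrict_def)
  have "csubspace ?T"
    unfolding complex_vector.subspace_def inter
    using linear_operatorD[OF lin] complex_vector.subspace_0[OF M(1)] complex_vector.subspace_add[OF M(1)]
      complex_vector.subspace_scale[OF M(1)]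
    by (auto simp: zero_prod_def scaleC_prod_def)
  moreover have "single_valued ?T"
    using lin unfolding linear_operator_def inter single_valued_def by blast
  moreover have "closed ?T"
    using T(1) M(2) unfolding inter closed_operator_def by (intro closed_Int closed_Times) simp_all
  ultimately have "closed_operator ?T"
    by (simp add: closed_operator_def linear_operator_def)
  moreover have "densely_defined_in M ?T"
  proof -
    have "x \<in> closure (Domain ?T)" if x: "x \<in> M" for x
      unfolding closure_approachable
    proof (intro allI impI)
      fix e :: real assume "e > 0"
      have "x \<in> closure (Domain T)"
        using T(2) by (auto simp: densely_defined_in_def)
      then obtain a b where ab: "(a, b) \<in> T" "dist a x < e"
        using \<open>e > 0\<close> unfolding closure_approachable by blast
      have "(P a, P b) \<in> ?T"
        using intertwinesD[OF PT(1) ab(1)] M(3) by (simp add: op_restrict_def)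
      moreover have "dist (P a) x < e"
        using is_projection_norm_diff[OF P x, of a] ab(2) by (simp add: dist_norm)
      ultimately show "\<exists>y\<in>Domain ?T. dist y x < e" by blast
    qed
    then show ?thesis
      by (auto simp: densely_defined_in_def op_restrict_def)
  qed
  moreover have "?T' \<circ>\<^sub>o ?T = ?T \<circ>\<^sub>o ?T'"
  proof -
    have fixed: "s \<in> M" if "(x, s) \<in> T \<or> (x, s) \<in> op_adj T" "x \<in> M" for x s
      using reduces_if_projection_intertwines[OF P T(1) PT(1)]
        reduces_if_projection_intertwines[OF P T'(1) PT(2)] that
      unfolding reduces_def invariant_under_def by blast
    have sum: "balanced T (x + z)" if "x \<in> M" "z \<in> M" for x z
      using balanced complex_vector.subspace_add[OF M(1) that] by blast
    \<comment> \<open>Here \<open>x\<close> is the resolvent at \<open>x + z\<close>, a vector of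
      \<open>M\<close>; agreement of the two resolvents there puts \<open>x\<close> into the domain
      of the product in the other order, with the same value \<open>z\<close>.\<close>
    have 1: "\<exists>s. (x, s) \<in> op_adj T \<and> (s, z) \<in> T"
      if xz: "x \<in> M" "z \<in> M" "(x, y) \<in> T" "(y, z) \<in> op_adj T" for x y z
    proof -
      have "resolvent_triple T (x + z) x y"
        using xz by (simp add: resolvent_triple_def)
      then obtain s where "resolvent_triple (op_adj T) (x + z) x s"
        using sum[OF xz(1,2)] resolvent_triple_unique(1)[OF lin T(2)] unfolding balanced_def by blast
      then show ?thesis
        by (auto simp: resolvent_triple_def op_adj_op_adj T(1))
    qed
    have 2: "\<exists>t. (x, t) \<in> T \<and> (t, z) \<in> op_adj T"
      if xz: "x \<in> M" "z \<in> M" "(x, y) \<in> op_adj T" "(y, z) \<in> T" for x y z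
    proof -
      have "resolvent_triple (op_adj T) (x + z) x y"
        using xz by (simp add: resolvent_triple_def op_adj_op_adj T(1))
      then obtain t where "resolvent_triple T (x + z) x t"
        using sum[OF xz(1,2)] resolvent_triple_unique(1)[OF lin' T'(2)] unfolding balanced_def by blast
      then show ?thesis
        by (auto simp: resolvent_triple_def)
    qed
    show ?thesis
    proof (intro equalityI subrelI)
      fix x z assume "(x, z) \<in> ?T' \<circ>\<^sub>o ?T"
      then obtain y where xz: "x \<in> M" "z \<in> M" "(x, y) \<in> T" "(y, z) \<in> op_adj T"
        by (auto simp: op_comp_def op_restrict_def)
      then obtain s where s: "(x, s) \<in> op_adj T" "(s, z) \<in> T"
        using 1 by blast
      then have "s \<in> M"
        using fixed xz(1) by blast
      with s xz show "(x, z) \<in> ?T \<circ>\<^sub>o ?T'"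
        by (auto simp: op_comp_def op_restrict_def)
    next
      fix x z assume "(x, z) \<in> ?T \<circ>\<^sub>o ?T'"
      then obtain y where xz: "x \<in> M" "z \<in> M" "(x, y) \<in> op_adj T" "(y, z) \<in> T"
        by (auto simp: op_comp_def op_restrict_def)
      then obtain t where t: "(x, t) \<in> T" "(t, z) \<in> op_adj T"
        using 2 by blast
      then have "t \<in> M"
        using fixed xz(1) by blast
      with t xz show "(x, z) \<in> ?T' \<circ>\<^sub>o ?T"
        by (auto simp: op_comp_def op_restrict_def)
    qed
  qed
  ultimately show ?thesis
    unfolding normal_in_def adjoint_in_op_restrict[OF P PT(1)] by (simp add: inter)
qed

text \<open>The iterates of the contraction \<open>1 - AA\<^sup>*/c\<^sup>2\<close> converge strongly to the projection onto its
  fixed space \<open>ker A\<^sup>*\<close>.\<close>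

lemma closure_range_projection:
  fixes A :: "'a::complex_hilbert \<Rightarrow> 'b::complex_hilbert"
  assumes A: "adjoint_pair A A'"
  obtains P where "is_projection P (closure (range A))"
    "\<And>x. A' (x - P x) = 0"
    "\<And>G. closed_operator G \<Longrightarrow> intertwines (\<lambda>x. A (A' x)) G G \<Longrightarrow> intertwines P G G"
proof -
  have bA: "bounded_clinear_map A" and bA': "bounded_clinear_map A'"
    using A by (simp_all add: adjoint_pair_def)
  note linA = bounded_clinear_mapD[OF bA] and linA' = bounded_clinear_mapD[OF bA']
  obtain c where c: "c > 0" "\<And>x. norm (A x) \<le> c * norm x"
    using bounded_clinear_map_bound[OF bA] by blast
  \<comment> \<open>The factor is small enough for \<open>E\<close> to be a contraction, with the
    decrease quantified in \<open>E_norm\<close>.\<close>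
  define k where "k = complex_of_real (1 / c\<^sup>2)"
  define E where "E x = x - k *\<^sub>C A (A' x)" for x
  have linE: "E (x + y) = E x + E y" "E (a *\<^sub>C x) = a *\<^sub>C E x" for x y a
    by (simp_all add: E_def linA linA' scaleC_add_right scaleC_diff_right scaleC_scaleC mult.commute)
  have E_norm: "(norm (E x))\<^sup>2 \<le> (norm x)\<^sup>2 - (norm (A' x))\<^sup>2 / c\<^sup>2" for x
  proof -
    have "cinner (A (A' x)) x = cinner (A' x) (A' x)"
      using adjoint_pairD[OF A] .
    then have "inner (A (A' x)) x = (norm (A' x))\<^sup>2"
      by (simp add: inner_eq_Re_cinner cinner_self)
    moreover have "E x = x - (1 / c\<^sup>2) *\<^sub>R A (A' x)"
      by (simp add: E_def k_def scaleR_scaleC)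
    moreover have "(norm (x - r *\<^sub>R v))\<^sup>2 = (norm x)\<^sup>2 - 2 * r * inner v x + r * r * (norm v)\<^sup>2" for r v
      by (simp add: power2_norm_eq_inner inner_simps algebra_simps inner_commute)
    ultimately have "(norm (E x))\<^sup>2 = (norm x)\<^sup>2 - 2 / c\<^sup>2 * (norm (A' x))\<^sup>2 + (1 / c\<^sup>2) * (1 / c\<^sup>2) * (norm (A (A' x)))\<^sup>2"
      by simp
    also have "(norm (A (A' x)))\<^sup>2 \<le> c\<^sup>2 * (norm (A' x))\<^sup>2"
      using power_mono[OF c(2)[of "A' x"], of 2] by (simp add: power_mult_distrib)
    then have "(1 / c\<^sup>2) * (1 / c\<^sup>2) * (norm (A (A' x)))\<^sup>2 \<le> (1 / c\<^sup>2) * (1 / c\<^sup>2) * (c\<^sup>2 * (norm (A' x))\<^sup>2)"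
      by (intro mult_left_mono) simp_all
    also have "(1 / c\<^sup>2) * (1 / c\<^sup>2) * (c\<^sup>2 * (norm (A' x))\<^sup>2) = (norm (A' x))\<^sup>2 / c\<^sup>2"
      using c(1) by (simp add: power2_eq_square)
    finally show ?thesis by (simp add: field_simps)
  qed
  have E_contraction: "norm (E x) \<le> norm x" for x
  proof -
    have "(norm (A' x))\<^sup>2 / c\<^sup>2 \<ge> 0"
      by simp
    then have "(norm (E x))\<^sup>2 \<le> (norm x)\<^sup>2"
      using E_norm[of x] by linarith
    then show ?thesis by simp
  qed
  have E_sym: "cinner (E x) y = cinner x (E y)" for x y
    using adjoint_pairD[OF A] adjoint_pairD[OF adjoint_pair_sym[OF A]]
    by (simp add: E_def k_def cinner.diff_left cinner.diff_right cinner_scaleC_left cinner_scaleC_right)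
  have bE: "bounded_clinear_map E"
    unfolding bounded_clinear_map_def clinear_map_def using linE E_contraction
    by (auto intro: exI[of _ 1])
  have pow_sym: "cinner ((E ^^ n) x) y = cinner x ((E ^^ n) y)" for n x y
    by (induction n arbitrary: y) (simp_all add: E_sym funpow_swap1[symmetric])
  have pow_add: "(E ^^ m) ((E ^^ n) x) = (E ^^ (m + n)) x" for m n x
    by (simp add: funpow_add)
  \<comment> \<open>By symmetry of \<open>E\<close>, the pairing of the powers \<open>2 * i\<close>
    and \<open>2 * j\<close> is the squared norm of the power \<open>i + j\<close>. These squared
    norms decrease and so converge; even exponents make \<open>i + j\<close> an integer
    index.\<close>
  have conv: "\<exists>q. (\<lambda>n. (E ^^ (2 * n)) x) \<longlonglongrightarrow> q" for x
  proof -
    define b where "b n = (norm ((E ^^ n) x))\<^sup>2" for n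
    have "decseq b"
      unfolding decseq_Suc_iff b_def by (simp add: E_contraction)
    then have "convergent b"
      by (intro Bseq_monoseq_convergent)
        (auto simp: decseq_imp_monoseq b_def intro!: decseq_bounded[where B = 0])
    then have "Cauchy b"
      by (simp add: Cauchy_convergent_iff)
    have diff: "(norm ((E ^^ (2 * i)) x - (E ^^ (2 * j)) x))\<^sup>2 = b (2 * i) - 2 * b (i + j) + b (2 * j)" for i j
    proof -
      have "cinner ((E ^^ (2 * i)) x) ((E ^^ (2 * j)) x) = cinner ((E ^^ (i + j)) x) ((E ^^ (i + j)) x)"
      proof -
        have "2 * i + 2 * j = i + j + (i + j)"
          by simp
        then show ?thesis
          unfolding pow_sym pow_add by (simp only:)
      qed
      then have "inner ((E ^^ (2 * i)) x) ((E ^^ (2 * j)) x) = b (i + j)"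
        by (simp add: inner_eq_Re_cinner cinner_self b_def)
      then show ?thesis
        by (simp add: b_def power2_norm_eq_inner inner_diff_left inner_diff_right inner_commute)
    qed
    have "Cauchy (\<lambda>n. (E ^^ (2 * n)) x)"
    proof (rule metric_CauchyI)
      fix e :: real assume "e > 0"
      then obtain m where m: "\<And>i j. i \<ge> m \<Longrightarrow> j \<ge> m \<Longrightarrow> dist (b i) (b j) < e\<^sup>2 / 2"
        using metric_CauchyD[OF \<open>Cauchy b\<close>, of "e\<^sup>2 / 2"] by auto
      have "dist ((E ^^ (2 * i)) x) ((E ^^ (2 * j)) x) < e" if "i \<ge> m" "j \<ge> m" for i j
      proof -
        have "\<bar>b (2 * i) - b (i + j)\<bar> < e\<^sup>2 / 2" "\<bar>b (2 * j) - b (i + j)\<bar> < e\<^sup>2 / 2"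
          using m[of "2 * i" "i + j"] m[of "2 * j" "i + j"] that by (simp_all add: dist_real_def)
        then have "(norm ((E ^^ (2 * i)) x - (E ^^ (2 * j)) x))\<^sup>2 < e\<^sup>2"
          unfolding diff by linarith
        then show ?thesis
          using \<open>e > 0\<close> by (simp add: dist_norm power2_less_imp_less)
      qed
      then show "\<exists>m. \<forall>i\<ge>m. \<forall>j\<ge>m. dist ((E ^^ (2 * i)) x) ((E ^^ (2 * j)) x) < e" by blast
    qed
    then show ?thesis
      using Cauchy_convergent convergent_def by blast
  qed
  then obtain Q where Q: "\<And>x. (\<lambda>n. (E ^^ (2 * n)) x) \<longlonglongrightarrow> Q x"
    by metis
  \<comment> \<open>\<open>E\<close> applied twice fixes the limit, so \<open>E\<close> loses no
    norm on it and the decrease in \<open>E_norm\<close> must be zero.\<close>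
  have Q_ker: "A' (Q x) = 0" for x
  proof -
    have "(\<lambda>n. E (E ((E ^^ (2 * n)) x))) \<longlonglongrightarrow> E (E (Q x))"
      by (intro bounded_clinear_map_tendsto[OF bE] Q)
    moreover have "(\<lambda>n. E (E ((E ^^ (2 * n)) x))) \<longlonglongrightarrow> Q x"
      using LIMSEQ_Suc[OF Q[of x]] by simp
    ultimately have "E (E (Q x)) = Q x"
      by (rule LIMSEQ_unique)
    then have "norm (Q x) \<le> norm (E (Q x))"
      using E_contraction[of "E (Q x)"] by simp
    then have "(norm (Q x))\<^sup>2 \<le> (norm (E (Q x)))\<^sup>2"
      by simp
    then have "(norm (A' (Q x)))\<^sup>2 / c\<^sup>2 \<le> 0"
      using E_norm[of "Q x"] by linarith
    then show ?thesis
      using c(1) by (simp add: divide_le_0_iff)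
  qed
  define P where "P x = x - Q x" for x
  have sub: "csubspace (range A)"
    unfolding complex_vector.subspace_def
  proof (intro conjI ballI allI)
    show "0 \<in> range A"
      using linA(3) by (metis rangeI)
    show "x + y \<in> range A" if "x \<in> range A" "y \<in> range A" for x y
      using that by (auto simp flip: linA(1))
    show "a *\<^sub>C x \<in> range A" if "x \<in> range A" for a x
      using that by (auto simp flip: linA(2))
  qed
  have pow_range: "x - (E ^^ n) x \<in> range A" for n x
  proof (induction n)
    case 0
    show ?case using complex_vector.subspace_0[OF sub] by simp
  next
    case (Suc n)
    have "x - (E ^^ Suc n) x = (x - (E ^^ n) x) + A (k *\<^sub>C A' ((E ^^ n) x))"
      by (simp add: E_def linA)
    then show ?case
      using complex_vector.subspace_add[OF sub Suc rangeI] by (simp only:)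
  qed
  have P_range: "P x \<in> closure (range A)" for x
    unfolding closure_sequential P_def
    by (intro exI[of _ "\<lambda>n. x - (E ^^ (2 * n)) x"] conjI allI pow_range tendsto_diff tendsto_const Q)
  have ker_orth: "q \<in> ortho_compl (closure (range A))" if q: "A' q = 0" for q
    unfolding ortho_compl_def
  proof (intro CollectI ballI)
    fix y assume "y \<in> closure (range A)"
    then obtain s where s: "\<And>n. s n \<in> range A" "s \<longlonglongrightarrow> y"
      unfolding closure_sequential by blast
    have "cinner q (s n) = 0" for n
      using s(1)[of n] adjoint_pairD[OF adjoint_pair_sym[OF A], of q] q by (auto simp: cinner.zero_left)
    then have "(\<lambda>n. 0) \<longlonglongrightarrow> cinner q y"
      using cinner.tendsto[OF tendsto_const[of q] s(2)] by simp
    then show "cinner q y = 0"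
      by (simp add: LIMSEQ_const_iff)
  qed
  show thesis
  proof (rule that)
    show "is_projection P (closure (range A))"
      unfolding is_projection_def using csubspace_closure[OF sub] P_range ker_orth[OF Q_ker]
      by (simp add: P_def)
    show "A' (x - P x) = 0" for x
      by (simp add: P_def Q_ker)
    fix G assume G: "closed_operator G" "intertwines (\<lambda>x. A (A' x)) G G"
    note linG = closed_operatorD[OF G(1)]
    show "intertwines P G G"
      unfolding intertwines_def
    proof (intro allI impI)
      fix x y assume xy: "(x, y) \<in> G"
      have E_G: "(E u, E v) \<in> G" if "(u, v) \<in> G" for u v
        unfolding E_def using that linG(3,4) intertwinesD[OF G(2) that] by blast
      \<comment> \<open>The powers of \<open>E\<close> preserve the closed graph \<open>G\<close>;
        their strong limit therefore does too.\<close>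
      have "((E ^^ n) x, (E ^^ n) y) \<in> G" for n
        by (induction n) (simp_all add: xy E_G)
      then have "(Q x, Q y) \<in> G"
        using closed_operator_tendsto[OF G(1) _ Q Q] by blast
      then show "(P x, P y) \<in> G"
        unfolding P_def using linG(4) xy by blast
    qed
  qed
qed

section \<open>The asymmetric theorem\<close>

text \<open>\<open>X = A V'\<close> intertwines the normal operator \<open>op_adj S\<close> with
  \<open>T\<close>, and \<open>X V = A\<close> brings the conclusions for \<open>X\<close> back to
  the original space.\<close>

lemma subnormal_M_hyponormal:
  fixes A :: "'h::complex_hilbert \<Rightarrow> 'k::complex_hilbert"
  assumes A: "bounded_clinear_map A" and B: "subnormal TYPE('l::complex_hilbert) B"
    and T: "M_hyponormal T" and AB: "intertwines A (op_adj B) T"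
  shows "intertwines A B (op_adj T)" "balanced T (A u)"
proof -
  obtain V :: "'h \<Rightarrow> 'l" and S where V: "clinear_map V" "\<And>x y. cinner (V x) (V y) = cinner x y"
    and S: "normal S" and BS: "intertwines V B S"
    using B unfolding subnormal_def intertwines_def by blast
  have "complex_of_real ((norm (V x))\<^sup>2) = complex_of_real ((norm x)\<^sup>2)" for x
    unfolding cinner_self[symmetric] by (rule V(2))
  then have "(norm (V x))\<^sup>2 = (norm x)\<^sup>2" for x
    using of_real_eq_iff by blast
  then have "norm (V x) = norm x" for x
    by simp
  then have "bounded_clinear_map V"
    unfolding bounded_clinear_map_def using V(1) by (auto intro: exI[of _ 1])
  then obtain V' where V': "adjoint_pair V V'"
    using adjoint_exists by blast
  have V'V: "V' (V x) = x" for x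
    by (rule ext_cinner) (simp add: adjoint_pairD[OF V', symmetric] V(2))
  note S_adj = op_adj_op_adj[OF normalD(1)[OF S]]
  define X where "X x = A (V' x)" for x
  have X: "bounded_clinear_map X"
    unfolding X_def using A V' by (simp add: bounded_clinear_map_compose adjoint_pair_def)
  \<comment> \<open>The adjoint of \<open>V'\<close> reverses \<open>BS\<close>, leading from
    \<open>op_adj S\<close> to \<open>op_adj B\<close>; the hypothesis \<open>AB\<close> leads on to
    \<open>T\<close>.\<close>
  have XS: "intertwines X (op_adj S) T"
    unfolding X_def using intertwines_compose[OF AB intertwines_adjoint[OF V' BS]] .
  then have XS': "intertwines X S (op_adj T)"
    using normal_M_hyponormal_intertwines_adjoint[OF normal_op_adj[OF S] T X] by (simp add: S_adj)
  have XV: "X (V x) = A x" for x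
    by (simp add: X_def V'V)
  show "intertwines A B (op_adj T)"
    unfolding intertwines_def using intertwinesD[OF XS' intertwinesD[OF BS]] by (simp add: XV)
  have "closed_operator T"
    using T by (simp add: M_hyponormal_def)
  have "balanced T (X (V u))"
    by (rule balanced_intertwines[OF X, of "op_adj S"])
      (use normal_op_adj[OF S] XS XS' \<open>closed_operator T\<close> in
        \<open>simp_all add: S_adj normalD(1) normal_balanced\<close>)
  then show "balanced T (A u)" by (simp add: XV)
qed

text \<open>The two inclusions and their adjoints make \<open>A A'\<close> commute with
  \<open>T\<close> and its adjoint, and \<open>A' A\<close> with \<open>B\<close> and its adjoint.
  Agreement of resolvents on the range of \<open>A\<close> is carried to the range of
  \<open>A'\<close>.\<close>

lemma reduction_to_normal_parts:
  fixes A :: "'h::complex_hilbert \<Rightarrow> 'k::complex_hilbert"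
  assumes A: "adjoint_pair A A'"
    and B: "closed_operator B" "densely_defined B" and T: "closed_operator T" "densely_defined T"
    and AB: "intertwines A (op_adj B) T" "intertwines A B (op_adj T)"
    and balanced: "\<And>u. balanced T (A u)"
  shows "reduces (closure (range A')) B"
    "normal_in (closure (range A')) (op_restrict B (closure (range A')))"
    "reduces (closure (range A)) T"
    "normal_in (closure (range A)) (op_restrict T (closure (range A)))"
proof -
  have A'T: "intertwines A' (op_adj T) B" "intertwines A' T (op_adj B)"
    using intertwines_adjoint[OF A AB(1)] intertwines_adjoint[OF A AB(2)]
    by (simp_all add: op_adj_op_adj B T)
  note B' = op_adj_closed_operator[OF B(2)] and T' = op_adj_closed_operator[OF T(2)]
  obtain P where P: "is_projection P (closure (range A))" "\<And>x. A' (x - P x) = 0"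
    "\<And>G. closed_operator G \<Longrightarrow> intertwines (\<lambda>x. A (A' x)) G G \<Longrightarrow> intertwines P G G"
    using closure_range_projection[OF A] by blast
  obtain P' where P': "is_projection P' (closure (range A'))"
    "\<And>x. A (x - P' x) = 0"
    "\<And>G. closed_operator G \<Longrightarrow> intertwines (\<lambda>x. A' (A x)) G G \<Longrightarrow> intertwines P' G G"
    using closure_range_projection[OF adjoint_pair_sym[OF A]] by blast
  have PT: "intertwines P T T" "intertwines P (op_adj T) (op_adj T)"
    using P(3)[OF T(1) intertwines_compose[OF AB(1) A'T(2)]]
      P(3)[OF T' intertwines_compose[OF AB(2) A'T(1)]] by blast+
  have P'B: "intertwines P' B B" "intertwines P' (op_adj B) (op_adj B)"
    using P'(3)[OF B(1) intertwines_compose[OF A'T(1) AB(2)]]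
      P'(3)[OF B' intertwines_compose[OF A'T(2) AB(1)]] by blast+
  show "reduces (closure (range A)) T" "reduces (closure (range A')) B"
    using reduces_if_projection_intertwines[OF P(1) T(1) PT(1)]
      reduces_if_projection_intertwines[OF P'(1) B(1) P'B(1)] by blast+
  have balanced_T: "balanced T u" if u: "u \<in> closure (range A)" for u
    by (rule balanced_closure[OF T _ u]) (use balanced in blast)
  then show "normal_in (closure (range A)) (op_restrict T (closure (range A)))"
    by (rule normal_in_op_restrict[OF P(1) T PT])
  have bA': "bounded_clinear_map A'"
    using A by (simp add: adjoint_pair_def)
  \<comment> \<open>\<open>A'\<close> annihilates \<open>v - P v\<close>, so only \<open>P v\<close>
    matters; it lies in the closed range of \<open>A\<close>, where the resolvents of
    \<open>T\<close> agree.\<close>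
  have "balanced B (A' v)" for v
  proof -
    have "balanced (op_adj B) (A' (P v))"
      by (rule balanced_intertwines[where T = T])
        (use bA' A'T B' T(1) balanced_T[OF is_projectionD(3)[OF P(1)]] in
          \<open>simp_all add: op_adj_op_adj B\<close>)
    then have "balanced B (A' (P v))"
      using balanced_op_adj[OF B'] by (simp add: op_adj_op_adj B)
    then show ?thesis
      using P(2)[of v] bounded_clinear_mapD(4)[OF bA'] by simp
  qed
  then have "balanced B u" if u: "u \<in> closure (range A')" for u
    by (intro balanced_closure[OF B _ u]) blast
  then show "normal_in (closure (range A')) (op_restrict B (closure (range A')))"
    by (rule normal_in_op_restrict[OF P'(1) B P'B])
qed

theorem theorem2p8:
  fixes A :: "'h::complex_hilbert \<Rightarrow> 'k::complex_hilbert"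
    and B :: "('h \<times> 'h) set"
    and T :: "('k \<times> 'k) set"
  assumes "infinite_dimensional TYPE('h)" and "infinite_dimensional TYPE('k)"
    and "bounded_clinear_map A"
    and "closed_operator B" and "densely_defined B"
    and "closed_operator T" and "densely_defined T"
    and "(subnormal TYPE('l1::complex_hilbert) B \<and> M_hyponormal T) \<or>
         (M_hyponormal B \<and> subnormal TYPE('l2::complex_hilbert) T)"
    and "op_of A \<circ>\<^sub>o op_adj B \<subseteq> T \<circ>\<^sub>o op_of A"
  shows "op_of A \<circ>\<^sub>o B \<subseteq> op_adj T \<circ>\<^sub>o op_of A \<and>
         (reduces (closure (Range (op_adj (op_of A)))) B \<and>
          normal_in (closure (Range (op_adj (op_of A))))
            (op_restrict B (closure (Range (op_adj (op_of A)))))) \<and>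
         (reduces (closure (range A)) T \<and>
          normal_in (closure (range A)) (op_restrict T (closure (range A))))"
proof -
  note B = assms(4,5) and T = assms(6,7)
  obtain A' where A': "adjoint_pair A A'"
    using adjoint_exists[OF assms(3)] by blast
  then have bA': "bounded_clinear_map A'"
    by (simp add: adjoint_pair_def)
  have Range: "Range (op_adj (op_of A)) = range A'"
    unfolding op_adj_op_of[OF A'] by (auto simp: op_of_def)
  have AB: "intertwines A (op_adj B) T"
    using assms(9) by (simp add: op_comp_subset_iff)
  have A'T: "intertwines A' (op_adj T) B"
    using intertwines_adjoint[OF A' AB] by (simp add: op_adj_op_adj B)
  show ?thesis
    unfolding Range op_comp_subset_iff
    using assms(8)
  proof
    assume "subnormal TYPE('l1) B \<and> M_hyponormal T"
    then have *: "intertwines A B (op_adj T)" "\<And>u. balanced T (A u)"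
      using subnormal_M_hyponormal[OF assms(3) _ _ AB] by blast+
    then show "intertwines A B (op_adj T) \<and>
      (reduces (closure (range A')) B \<and>
        normal_in (closure (range A')) (op_restrict B (closure (range A')))) \<and>
      (reduces (closure (range A)) T \<and>
        normal_in (closure (range A)) (op_restrict T (closure (range A))))"
      using reduction_to_normal_parts[OF A' B T AB *] by blast
  next
    \<comment> \<open>The adjoint inclusion \<open>A'T\<close> has the shape of the hypothesis with
      \<open>A'\<close>, \<open>T\<close>, \<open>B\<close> in place of \<open>A\<close>,
      \<open>B\<close>, \<open>T\<close>.\<close>
    assume "M_hyponormal B \<and> subnormal TYPE('l2) T"
    then have *: "intertwines A' T (op_adj B)" "\<And>u. balanced B (A' u)"
      using subnormal_M_hyponormal[OF bA' _ _ A'T] by blast+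
    \<comment> \<open>The first conclusion for \<open>A'\<close> is turned into the one for
      \<open>A\<close> by taking adjoints.\<close>
    have "intertwines A B (op_adj T)"
      using intertwines_adjoint[OF adjoint_pair_sym[OF A'] *(1)] by (simp add: op_adj_op_adj B)
    then show "intertwines A B (op_adj T) \<and>
      (reduces (closure (range A')) B \<and>
        normal_in (closure (range A')) (op_restrict B (closure (range A')))) \<and>
      (reduces (closure (range A)) T \<and>
        normal_in (closure (range A)) (op_restrict T (closure (range A))))"
      using reduction_to_normal_parts[OF adjoint_pair_sym[OF A'] T B A'T *] by blast
  qed
qed

end
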